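(* For every $n\geq 13$, $\gamma_{MB}(P_2\square P_n)=n-2$.
   Context: $P_k$ is the path on $k$ vertices and $\square$ the Cartesian product, so $P_2\square P_n$ is the $2\times n$ grid. In the Maker–Breaker domination game on a graph $G$, two players, Dominator and Staller, alternately claim previously unclaimed vertices of $G$. Dominator wins if the set of vertices he claims becomes a dominating set of $G$ (every vertex not in it has a neighbour in it); Staller wins if she claims some vertex together with all of its neighbours. In the $D$-game Dominator moves first. $\gamma_{MB}(G)$ is the minimum number of moves Dominator needs to win the $D$-game on $G$ against optimal play by Staller (who tries to postpone his win). *)

theory Defs
  imports
    "Graph_Theory.Pair_Digraph"
    "HOL-Library.Extended_Nat"
begin

text \<open>
  A finite simple graph is a \<^locale>\<open>pair_graph\<close>: a finite digraph without loops and
  parallel arcs whose arc set is symmetric, every edge being present in both directions.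
\<close>

definition path_graph :: "nat \<Rightarrow> nat pair_pre_digraph" where
  "path_graph n =
     \<lparr> pverts = {..<n},
       parcs = {(i, j). i < n \<and> j < n \<and> (j = Suc i \<or> i = Suc j)} \<rparr>"

definition cartesian_product ::
    "'a pair_pre_digraph \<Rightarrow> 'b pair_pre_digraph \<Rightarrow> ('a \<times> 'b) pair_pre_digraph"
    (infixr "\<box>" 75) where
  "G \<box> H =
     \<lparr> pverts = pverts G \<times> pverts H,
       parcs = {((u, x), (v, y)).
                  u = v \<and> u \<in> pverts G \<and> (x, y) \<in> parcs H \<or>
                  (u, v) \<in> parcs G \<and> x = y \<and> x \<in> pverts H} \<rparr>"

lemma pair_graph_path_graph: "pair_graph (path_graph n)"
proof
  show "finite (parcs (path_graph n))"
    by (rule finite_subset[of _ "{..<n} \<times> {..<n}"]) (auto simp: path_graph_def)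
qed (auto simp: path_graph_def symmetric_def intro: symI)

lemma pair_graph_cartesian_product:
  assumes "pair_graph G" and "pair_graph H"
  shows "pair_graph (G \<box> H)"
proof -
  interpret G: pair_graph G by fact
  interpret H: pair_graph H by fact
  have symG: "sym (parcs G)" and symH: "sym (parcs H)"
    using G.pair_sym_arcs H.pair_sym_arcs by (simp_all add: symmetric_def)
  show ?thesis
  proof
    show "finite (parcs (G \<box> H))"
      by (rule finite_subset
            [of _ "(pverts G \<times> pverts H) \<times> (pverts G \<times> pverts H)"])
         (auto simp: cartesian_product_def G.pair_finite_verts H.pair_finite_verts
               dest: G.wellformed' H.wellformed')
  qed (use symG symH in
        \<open>auto simp: cartesian_product_def symmetric_def G.pair_finite_verts H.pair_finite_verts
              dest: G.wellformed' H.wellformed' G.pair_no_loops H.pair_no_loops symD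
              intro!: symI\<close>)
qed

definition dominating_set :: "'a pair_pre_digraph \<Rightarrow> 'a set \<Rightarrow> bool" where
  "dominating_set G D \<longleftrightarrow>
     D \<subseteq> pverts G \<and> (\<forall>v \<in> pverts G - D. \<exists>u \<in> D. (v, u) \<in> parcs G)"

definition staller_won :: "'a pair_pre_digraph \<Rightarrow> 'a set \<Rightarrow> bool" where
  "staller_won G S \<longleftrightarrow>
     (\<exists>v \<in> pverts G. v \<in> S \<and> (\<forall>u. (v, u) \<in> parcs G \<longrightarrow> u \<in> S))"

definition unclaimed :: "'a pair_pre_digraph \<Rightarrow> 'a set \<Rightarrow> 'a set \<Rightarrow> 'a set" where
  "unclaimed G D S = pverts G - (D \<union> S)"

text \<open>
  In a position, \<open>D\<close> and \<open>S\<close> are the sets of vertices claimed so far by Dominator and by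
  Staller. The predicate \<open>D_to_move G k D S\<close> (respectively \<open>S_to_move G k D S\<close>) says that,
  with Dominator (respectively Staller) to move, Dominator can force a win making at most
  \<open>k\<close> further moves himself, whatever Staller plays. The premise that a vertex is left
  for Staller to claim excludes a full board on which Dominator has not won; a position
  already won by Staller is never derivable, because \<open>D\<close> and \<open>S\<close> are disjoint.
\<close>

inductive D_to_move :: "'a pair_pre_digraph \<Rightarrow> nat \<Rightarrow> 'a set \<Rightarrow> 'a set \<Rightarrow> bool"
  and S_to_move :: "'a pair_pre_digraph \<Rightarrow> nat \<Rightarrow> 'a set \<Rightarrow> 'a set \<Rightarrow> bool"
  for G :: "'a pair_pre_digraph"
where
  D_won: "dominating_set G D \<Longrightarrow> D_to_move G k D S"
| D_move: "v \<in> unclaimed G D S \<Longrightarrow> S_to_move G k (insert v D) S \<Longrightarrow> D_to_move G (Suc k) D S"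
| S_lost: "dominating_set G D \<Longrightarrow> S_to_move G k D S"
| S_move: "unclaimed G D S \<noteq> {} \<Longrightarrow>
    (\<And>w. w \<in> unclaimed G D S \<Longrightarrow> D_to_move G k D (insert w S)) \<Longrightarrow> S_to_move G k D S"

lemma dominating_set_imp_not_staller_won:
  assumes "dominating_set G D" and "D \<inter> S = {}"
  shows "\<not> staller_won G S"
  using assms unfolding dominating_set_def staller_won_def by blast

lemma dominating_set_iff_not_staller_won:
  assumes "pair_graph G" and "D \<inter> S = {}" and "D \<union> S = pverts G"
  shows "dominating_set G D \<longleftrightarrow> \<not> staller_won G S"
proof -
  interpret pair_graph G by fact
  show ?thesis
    using assms(2,3) in_arcsD2 unfolding dominating_set_def staller_won_def by blast
qed

lemma not_staller_won_if_dominator_forces_win: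
  shows "D_to_move G k D S \<Longrightarrow> D \<inter> S = {} \<Longrightarrow> \<not> staller_won G S"
    and "S_to_move G k D S \<Longrightarrow> D \<inter> S = {} \<Longrightarrow> \<not> staller_won G S"
proof (induction rule: D_to_move_S_to_move.inducts)
  case (S_move D S k)
  then obtain w where "w \<in> unclaimed G D S" by blast
  with S_move have "\<not> staller_won G (insert w S)"
    by (auto simp: unclaimed_def)
  then show ?case by (auto simp: staller_won_def)
qed (auto simp: dominating_set_imp_not_staller_won unclaimed_def)

text \<open>
  The value is \<open>\<infinity>\<close> (the infimum of the empty set) if Dominator cannot force a win in
  the game in which he moves first.
\<close>

definition gamma_MB :: "'a pair_pre_digraph \<Rightarrow> enat" where
  "gamma_MB G = Inf {enat k | k. D_to_move G k {} {}}"

end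

(*
  The position is the hypergraph whose edges are the closed neighbourhoods of the vertices not yet
  dominated, without Staller's vertices: Dominator hits edges and Staller shrinks them. A position
  only gets harder for Dominator when edges are added or shrunk.

  Upper bound: Dominator starts at (0, 6). From column 13 on he pairs the two vertices of each
  column. The first 13 columns split into two mirror images meeting in the vertex (1, 6), and an
  explicit strategy dominates them in 10 further moves.

  Lower bound: Dominator's first vertex cuts the grid into two arms meeting in the other vertex of
  its column. Staller sweeps each arm from its outer end with forcing moves: each group of forced
  replies costs Dominator at least as many moves as it clears columns and leaves an arm in which
  exactly one vertex of the new first column is undominated, until both arms have at most three
  columns. Explicit strategies of Staller show that the number of moves needed on what remains is at
  least the number of columns left minus 2, so at least n - 3 moves follow Dominator's first one.
*)

theory Submission
  imports Defs
begin

section \<open>Hypergraph games\<close>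

text \<open>Pairing the two vertices of every column costs one move per column, so the value says
  that Dominator can save exactly two moves. For the upper bound, 13 columns are dominated with 1 +
  10 moves, which is this saving, and longer grids add one move per column. The lower bound has to
  cope with grids of any length and with replies anywhere on the board. Staller's forcing play is
  therefore local: a reply outside the strip of columns in play loses on edges lying inside that
  strip, whatever the rest of the position is. So the rest can be carried along as an inert set of
  edges, and one finite check serves every place and every length. The vertex shared by the arms
  never belongs to such a strip; its influence is confined to the final position of at most 3 + 3
  columns, which is why both ends are treated together there. All finite strategies are data run
  through evaluators, and only the soundness of the evaluators needs an induction.\<close>

definition hit :: "'a \<Rightarrow> 'a set set \<Rightarrow> 'a set set" where
  "hit v H = {e \<in> H. v \<notin> e}"

definition shrink :: "'a \<Rightarrow> 'a set set \<Rightarrow> 'a set set" where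
  "shrink w H = (\<lambda>e. e - {w}) ` H"

text \<open>
  An edge is what Staller still has to claim in the closed neighbourhood of an undominated
  vertex. Passing, as a move on a vertex in no edge, is allowed to both players; it never helps.
\<close>

primrec dwin :: "nat \<Rightarrow> 'a set set \<Rightarrow> bool" where
  "dwin 0 H \<longleftrightarrow> H = {}"
| "dwin (Suc k) H \<longleftrightarrow> (\<exists>v. \<forall>w. dwin k (shrink w (hit v H)))"

definition swin :: "nat \<Rightarrow> 'a set set \<Rightarrow> bool" where
  "swin k H \<longleftrightarrow> (\<forall>w. dwin k (shrink w H))"

lemma dwin_Suc: "dwin (Suc k) H \<longleftrightarrow> (\<exists>v. swin k (hit v H))"
  by (simp add: swin_def)

declare dwin.simps(2) [simp del]

text \<open>Read \<open>K \<sqsubseteq> H\<close> as: \<open>K\<close> is at least as hard for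
  Dominator as \<open>H\<close>. It covers both adding edges and shrinking them.\<close>

definition refines :: "'a set set \<Rightarrow> 'a set set \<Rightarrow> bool" (infix "\<sqsubseteq>" 50) where
  "K \<sqsubseteq> H \<longleftrightarrow> (\<forall>e \<in> H. \<exists>f \<in> K. f \<subseteq> e)"

lemma refines_superset: "H \<subseteq> K \<Longrightarrow> K \<sqsubseteq> H"
  by (auto simp: refines_def)

lemma refines_Un: "K \<sqsubseteq> H \<Longrightarrow> K' \<sqsubseteq> H' \<Longrightarrow> K \<union> K' \<sqsubseteq> H \<union> H'"
  unfolding refines_def by blast

lemma refines_hit: "K \<sqsubseteq> H \<Longrightarrow> hit v K \<sqsubseteq> hit v H"
  unfolding refines_def hit_def by blast

lemma refines_shrink: "K \<sqsubseteq> H \<Longrightarrow> shrink w K \<sqsubseteq> shrink w H"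
  unfolding refines_def shrink_def ball_simps bex_simps by (meson Diff_mono order_refl)

lemma shrink_refines: "shrink w H \<sqsubseteq> H"
  unfolding refines_def shrink_def bex_simps by (meson Diff_subset)

lemma refines_hit_same: "H \<sqsubseteq> hit v H"
  by (auto simp: refines_def hit_def)

lemma refines_hit_Un: "hit v H \<union> K \<sqsubseteq> hit v (H \<union> K)"
  by (auto simp: refines_def hit_def)

text \<open>Dominator copies his moves from \<open>K\<close>: hitting, or shrinking, both sides at
  the same vertex preserves the relation.\<close>

lemma dwin_mono: "dwin k K \<Longrightarrow> K \<sqsubseteq> H \<Longrightarrow> dwin k H"
proof (induction k arbitrary: K H)
  case 0
  then show ?case by (auto simp: refines_def)
next
  case (Suc k)
  then obtain v where v: "\<And>w. dwin k (shrink w (hit v K))" by (auto simp: dwin.simps(2))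
  have "dwin k (shrink w (hit v H))" for w
    using Suc.IH[OF v[of w]] Suc.prems(2) by (simp add: refines_hit refines_shrink)
  then show ?case by (auto simp: dwin.simps(2))
qed

lemma swin_mono: "swin k K \<Longrightarrow> K \<sqsubseteq> H \<Longrightarrow> swin k H"
  by (auto simp: swin_def intro: dwin_mono[OF _ refines_shrink])

lemma swin_imp_dwin: "swin k H \<Longrightarrow> dwin k H"
  unfolding swin_def by (erule allE, erule dwin_mono, rule shrink_refines)

lemma dwin_le_mono: "dwin k H \<Longrightarrow> k \<le> l \<Longrightarrow> dwin l H"
proof (induction k arbitrary: l H)
  case 0
  have "dwin l {}" for l
    by (induction l) (auto simp: dwin.simps(2) hit_def shrink_def)
  with 0 show ?case by auto
next
  case (Suc k)
  then obtain l' where l: "l = Suc l'" "k \<le> l'" by (cases l) auto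
  obtain v where v: "\<And>w. dwin k (shrink w (hit v H))"
    using Suc.prems by (auto simp: dwin.simps(2))
  have "dwin l' (shrink w (hit v H))" for w using Suc.IH[OF v l(2)] .
  then show ?case using l by (auto simp: dwin.simps(2))
qed

lemma swin_le_mono: "swin k H \<Longrightarrow> k \<le> l \<Longrightarrow> swin l H"
  by (auto simp: swin_def intro: dwin_le_mono)

lemma dwin_empty: "dwin k {}"
  using dwin_le_mono[of 0 "{}" k] by simp

lemma dwin_no_empty: "dwin k H \<Longrightarrow> {} \<notin> H"
proof (induction k arbitrary: H)
  case (Suc k)
  then obtain v where "swin k (hit v H)" by (auto simp: dwin_Suc)
  then have "{} \<notin> hit v H" using Suc.IH swin_imp_dwin by blast
  then show ?case by (auto simp: hit_def)
qed simp

lemma swin_0: "swin 0 H \<longleftrightarrow> H = {}"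
  by (auto simp: swin_def shrink_def)

text \<open>Staller completes the edge by claiming \<open>u\<close>; this threat is behind all her
  forcing moves.\<close>

lemma swin_no_single: "swin k H \<Longrightarrow> {u} \<notin> H"
  using dwin_no_empty[of k "shrink u H"] imageI[of "{u}" H "\<lambda>e. e - {u}"]
  by (auto simp: swin_def shrink_def)

lemma hit_Un: "hit v (H \<union> K) = hit v H \<union> hit v K"
  by (auto simp: hit_def)

lemma shrink_Un: "shrink w (H \<union> K) = shrink w H \<union> shrink w K"
  by (auto simp: shrink_def)

lemma hit_fresh: "v \<notin> \<Union>H \<Longrightarrow> hit v H = H"
  by (auto simp: hit_def)

lemma shrink_fresh: "w \<notin> \<Union>H \<Longrightarrow> shrink w H = H"
proof -
  assume "w \<notin> \<Union>H"
  then have "e - {w} = e" if "e \<in> H" for e using that by auto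
  then show "shrink w H = H" by (simp add: shrink_def)
qed

lemma Union_shrink: "\<Union>(shrink w H) = \<Union>H - {w}"
  by (auto simp: shrink_def)

lemma Union_hit: "\<Union>(hit v H) \<subseteq> \<Union>H"
  by (auto simp: hit_def)

text \<open>Dominator answers in the part in which Staller has just moved, so the budgets add
  up.\<close>

lemma swin_add:
  "swin a H \<Longrightarrow> swin b K \<Longrightarrow> \<Union>H \<inter> \<Union>K = {} \<Longrightarrow> swin (a + b) (H \<union> K)"
proof (induction "a + b" arbitrary: a b H K)
  case 0
  then show ?case by (simp add: swin_0)
next
  case (Suc n)
  have reply: "dwin (a + b) (shrink w H \<union> K)"
    if H: "swin a H" and K: "swin b K" and disj: "\<Union>H \<inter> \<Union>K = {}" and n: "Suc n = a + b"
    for a b w and H K :: "'a set set"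
  proof (cases a)
    \<comment> \<open>Without budget \<open>H\<close> is empty, so Staller's move there was a
      pass.\<close>
    case 0
    then show ?thesis using H K by (simp add: swin_0 shrink_def swin_imp_dwin)
  next
    case (Suc a')
    obtain v where v: "swin a' (hit v (shrink w H))"
      using H Suc by (auto simp: swin_def dwin_Suc)
    have "\<Union>(hit v (shrink w H)) \<inter> \<Union>K = {}"
      using disj Union_hit[of v "shrink w H"] Union_shrink[of w H] by blast
    then have "swin (a' + b) (hit v (shrink w H) \<union> K)"
      using Suc.hyps(1)[of a' b] n Suc v K by simp
    then have "swin (a' + b) (hit v (shrink w H \<union> K))"
      by (rule swin_mono) (rule refines_hit_Un)
    then show ?thesis using Suc by (auto simp: dwin_Suc)
  qed
  show ?case
    unfolding swin_def
  proof
    fix w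
    show "dwin (a + b) (shrink w (H \<union> K))"
    proof (cases "w \<in> \<Union>K")
      case True
      then have "shrink w H = H" using Suc.prems(3) by (intro shrink_fresh) auto
      then show ?thesis
        using reply[of b K a H w] Suc by (simp add: shrink_Un Un_commute add.commute Int_commute)
    next
      case False
      then have "shrink w K = K" by (rule shrink_fresh)
      then show ?thesis using reply[of a H b K w] Suc by (simp add: shrink_Un)
    qed
  qed
qed

lemma swin_pair:
  assumes "a \<noteq> b"
  shows "swin 1 {{a, b}}"
proof -
  have "dwin 1 (shrink w {{a, b}})" for w
  proof -
    have "hit (if w = a then b else a) (shrink w {{a, b}}) = {}"
      using assms by (simp add: hit_def shrink_def)
    then show ?thesis by (metis One_nat_def dwin_Suc swin_0)
  qed
  then show ?thesis by (simp add: swin_def)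
qed

text \<open>Pairing strategy: a claim of one vertex of a pair is answered by the other one.\<close>

lemma swin_pairs:
  "distinct (concat (map (\<lambda>(a, b). [a, b]) ps)) \<Longrightarrow>
    swin (length ps) ((\<lambda>(a, b). {a, b}) ` set ps)"
proof (induction ps)
  case Nil
  then show ?case by (simp add: swin_0)
next
  case (Cons p ps)
  obtain a b where p: "p = (a, b)" by force
  have "swin (1 + length ps) ({{a, b}} \<union> (\<lambda>(a, b). {a, b}) ` set ps)"
    using Cons p by (intro swin_add swin_pair) (auto simp: image_iff)
  then show ?case using p by simp
qed

text \<open>Vertices outside \<open>\<Union>H\<close> are passes. The image of a passing move of
  Dominator may hit an edge by accident, which is harmless by monotonicity, so injectivity on
  \<open>\<Union>H\<close> is enough.\<close>

lemma swin_image: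
  assumes "swin k H" "inj_on f (\<Union>H)"
  shows "swin k ((`) f ` H)"
  using assms
proof (induction k arbitrary: H)
  case 0
  then show ?case by (simp add: swin_0)
next
  case (Suc k)
  have hit_im: "hit (f v) ((`) f ` H) = (`) f ` hit v H"
    if "inj_on f (\<Union>H)" "v \<in> \<Union>H" for v and H :: "'a set set"
  proof -
    have "f v \<in> f ` e \<longleftrightarrow> v \<in> e" if "e \<in> H" for e
      using that \<open>inj_on f (\<Union>H)\<close> \<open>v \<in> \<Union>H\<close> by (intro inj_on_image_mem_iff) auto
    then show ?thesis by (auto simp: hit_def)
  qed
  have shrink_im: "shrink (f v) ((`) f ` H) = (`) f ` shrink v H"
    if "inj_on f (\<Union>H)" "v \<in> \<Union>H" for v and H :: "'a set set"
  proof -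
    have "f ` e - {f v} = f ` (e - {v})" if "e \<in> H" for e
      using inj_on_image_set_diff[OF \<open>inj_on f (\<Union>H)\<close>, of e "{v}"] that \<open>v \<in> \<Union>H\<close> by auto
    then show ?thesis by (simp add: shrink_def image_image)
  qed
  have main: "dwin (Suc k) ((`) f ` J)" if J: "dwin (Suc k) J" "inj_on f (\<Union>J)" for J
  proof -
    obtain v where v: "swin k (hit v J)" using J by (auto simp: dwin_Suc)
    have inj: "inj_on f (\<Union>(hit v J))"
      by (rule inj_on_subset[OF J(2) Union_hit])
    have "swin k (hit (f v) ((`) f ` J))"
    proof (cases "v \<in> \<Union>J")
      case True
      then show ?thesis using hit_im[OF J(2)] Suc.IH[OF v inj] by simp
    next
      case False
      then have "hit v J = J" by (rule hit_fresh)
      then show ?thesis using Suc.IH[OF v inj] refines_hit_same swin_mono by metis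
    qed
    then show ?thesis by (auto simp: dwin_Suc)
  qed
  show ?case
    unfolding swin_def
  proof
    fix w
    show "dwin (Suc k) (shrink w ((`) f ` H))"
    proof (cases "w \<in> f ` \<Union>H")
      case True
      then obtain v where v: "v \<in> \<Union>H" "w = f v" by auto
      have "inj_on f (\<Union>(shrink v H))"
        using Suc.prems(2) Union_shrink[of v H] by (auto intro: inj_on_subset)
      moreover have "dwin (Suc k) (shrink v H)" using Suc.prems(1) by (simp add: swin_def)
      ultimately show ?thesis using main v shrink_im[OF Suc.prems(2)] by simp
    next
      case False
      then have "shrink w ((`) f ` H) = (`) f ` H"
        by (intro shrink_fresh) auto
      then show ?thesis using main Suc.prems swin_imp_dwin by metis
    qed
  qed
qed

lemma dwin_image:
  assumes "dwin k H" "inj_on f (\<Union>H)"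
  shows "dwin k ((`) f ` H)"
proof (cases k)
  case 0
  then show ?thesis using assms by simp
next
  case (Suc l)
  obtain v where v: "swin l (hit v H)" using assms Suc by (auto simp: dwin_Suc)
  have inj: "inj_on f (\<Union>(hit v H))"
    by (rule inj_on_subset[OF assms(2) Union_hit])
  have "hit (f v) ((`) f ` H) \<subseteq> (`) f ` hit v H"
    by (auto simp: hit_def)
  then have "swin l (hit (f v) ((`) f ` H))"
    by (rule swin_mono[OF swin_image[OF v inj] refines_superset])
  then show ?thesis using Suc by (auto simp: dwin_Suc)
qed

section \<open>The domination game as a hypergraph game\<close>

definition closed_nbh :: "'a pair_pre_digraph \<Rightarrow> 'a \<Rightarrow> 'a set" where
  "closed_nbh G v = insert v {u. (v, u) \<in> parcs G}"

definition edges_left :: "'a pair_pre_digraph \<Rightarrow> 'a set \<Rightarrow> 'a set \<Rightarrow> 'a set set" where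
  "edges_left G D S = {closed_nbh G v - S | v. v \<in> pverts G \<and> closed_nbh G v \<inter> D = {}}"

lemma edges_left_insert_D:
  assumes "v \<notin> S"
  shows "edges_left G (insert v D) S = hit v (edges_left G D S)"
  using assms unfolding edges_left_def hit_def by blast

lemma edges_left_insert_S: "edges_left G D (insert w S) = shrink w (edges_left G D S)"
proof -
  have "A - insert w S = A - S - {w}" for A by blast
  then show ?thesis by (simp add: edges_left_def shrink_def setcompr_eq_image image_image)
qed

lemma edges_left_empty:
  assumes "D \<subseteq> pverts G"
  shows "edges_left G D S = {} \<longleftrightarrow> dominating_set G D"
  using assms unfolding edges_left_def dominating_set_def closed_nbh_def by blast

lemma Union_edges_left:
  assumes "\<And>v u. (v, u) \<in> parcs G \<Longrightarrow> u \<in> pverts G"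
  shows "\<Union>(edges_left G D S) \<subseteq> unclaimed G D S"
  using assms unfolding edges_left_def unclaimed_def closed_nbh_def by blast

context
  fixes G :: "'a pair_pre_digraph"
  assumes wf: "\<And>v u. (v, u) \<in> parcs G \<Longrightarrow> u \<in> pverts G"
begin

lemma Union_edges_left_wf: "\<Union>(edges_left G D S) \<subseteq> unclaimed G D S"
  using wf by (rule Union_edges_left)

text \<open>In the real game Staller cannot pass. Any genuine claim of hers shrinks edges and is
  thus at least as hard for Dominator as a pass.\<close>

lemma to_move_imp_win:
  shows "D_to_move G k D S \<Longrightarrow> D \<subseteq> pverts G \<Longrightarrow> D \<inter> S = {} \<Longrightarrow> dwin k (edges_left G D S)"
    and "S_to_move G k D S \<Longrightarrow> D \<subseteq> pverts G \<Longrightarrow> D \<inter> S = {} \<Longrightarrow> swin k (edges_left G D S)"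
proof (induction rule: D_to_move_S_to_move.inducts)
  case (D_won D k S)
  then show ?case by (simp add: edges_left_empty[THEN iffD2] dwin_empty)
next
  case (D_move v D S k)
  then have "swin k (hit v (edges_left G D S))"
    by (auto simp: unclaimed_def edges_left_insert_D)
  then show ?case by (auto simp: dwin_Suc)
next
  case (S_lost D k S)
  then show ?case by (simp add: edges_left_empty[THEN iffD2] swin_def shrink_def dwin_empty)
next
  case (S_move D S k)
  have *: "dwin k (shrink w (edges_left G D S))" if "w \<in> unclaimed G D S" for w
    using S_move that by (auto simp: unclaimed_def edges_left_insert_S)
  obtain w where "w \<in> unclaimed G D S" using S_move(1) by blast
  then have pass: "dwin k (edges_left G D S)" by (rule dwin_mono[OF * shrink_refines])
  show ?case
    unfolding swin_def
  proof
    fix w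
    show "dwin k (shrink w (edges_left G D S))"
    proof (cases "w \<in> unclaimed G D S")
      case False
      then have "w \<notin> \<Union>(edges_left G D S)" using Union_edges_left_wf[of D S] by blast
      then show ?thesis using pass by (simp add: shrink_fresh)
    qed (rule *)
  qed
qed

text \<open>A pass by Dominator is replaced by a claim inside some remaining edge. Since no
  remaining edge is empty, a vertex is left for Staller, as \<open>S_move\<close> demands.\<close>

lemma win_imp_to_move:
  "dwin k (edges_left G D S) \<Longrightarrow> D \<subseteq> pverts G \<Longrightarrow> D \<inter> S = {} \<Longrightarrow> D_to_move G k D S"
proof (induction k arbitrary: D S)
  case 0
  then show ?case by (simp add: edges_left_empty D_won)
next
  case (Suc k)
  show ?case
  proof (cases "edges_left G D S = {}")
    case True
    then show ?thesis using Suc.prems by (simp add: edges_left_empty D_won)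
  next
    case False
    obtain v where v: "swin k (hit v (edges_left G D S))"
      using Suc.prems by (auto simp: dwin_Suc)
    obtain u where u: "u \<in> unclaimed G D S" "swin k (hit u (edges_left G D S))"
    proof (cases "v \<in> unclaimed G D S")
      case True
      then show ?thesis using that v by blast
    next
      case out: False
      then have "hit v (edges_left G D S) = edges_left G D S"
        using Union_edges_left_wf[of D S] by (intro hit_fresh) blast
      with v have E: "swin k (edges_left G D S)" by simp
      obtain u where "u \<in> \<Union>(edges_left G D S)"
        using False dwin_no_empty[OF Suc.prems(1)] by (metis Union_empty_conv ex_in_conv)
      with Union_edges_left_wf show ?thesis
        by (rule that[OF subsetD swin_mono[OF E refines_hit_same]])
    qed
    let ?D = "insert u D"
    have D: "?D \<subseteq> pverts G" "?D \<inter> S = {}"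
      using u Suc.prems by (auto simp: unclaimed_def)
    have win: "swin k (edges_left G ?D S)"
      using u by (simp add: edges_left_insert_D unclaimed_def)
    have "S_to_move G k ?D S"
    proof (cases "edges_left G ?D S = {}")
      case True
      then show ?thesis using D by (simp add: edges_left_empty S_lost)
    next
      case False
      moreover have "{} \<notin> edges_left G ?D S"
        using win dwin_no_empty swin_imp_dwin by blast
      ultimately have "unclaimed G ?D S \<noteq> {}"
        using Union_edges_left_wf[of ?D S] by (metis Union_empty_conv ex_in_conv subset_empty)
      then show ?thesis
      proof (rule S_move)
        fix w
        assume w: "w \<in> unclaimed G ?D S"
        have "dwin k (edges_left G ?D (insert w S))"
          using win by (simp add: swin_def edges_left_insert_S)
        then show "D_to_move G k ?D (insert w S)"
          using Suc.IH D w by (auto simp: unclaimed_def)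
      qed
    qed
    with u(1) show ?thesis by (rule D_move)
  qed
qed

lemma D_to_move_iff: "D_to_move G k {} {} \<longleftrightarrow> dwin k (closed_nbh G ` pverts G)"
proof -
  have "edges_left G {} {} = closed_nbh G ` pverts G"
    by (auto simp: edges_left_def)
  then show ?thesis
    using to_move_imp_win(1)[of k "{}" "{}"] win_imp_to_move[of k "{}" "{}"] by auto
qed

end

section \<open>Checking strategies of Staller\<close>

type_synonym hyp = "int list list"

definition hyper :: "hyp \<Rightarrow> int set set" where
  "hyper H = set ` set H"

definition lhit :: "int \<Rightarrow> hyp \<Rightarrow> hyp" where
  "lhit v H = filter (\<lambda>e. v \<notin> set e) H"

definition lshrink :: "int \<Rightarrow> hyp \<Rightarrow> hyp" where
  "lshrink w H = map (filter (\<lambda>v. v \<noteq> w)) H"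

definition lrefines :: "hyp \<Rightarrow> hyp \<Rightarrow> bool" where
  "lrefines K H \<longleftrightarrow> (\<forall>e \<in> set H. \<exists>f \<in> set K. \<forall>v \<in> set f. v \<in> set e)"

lemma hyper_lhit: "hyper (lhit v H) = hit v (hyper H)"
  by (auto simp: hyper_def lhit_def hit_def)

lemma hyper_lshrink: "hyper (lshrink w H) = shrink w (hyper H)"
proof -
  have "{x \<in> e. x \<noteq> w} = e - {w}" for e :: "int set" by auto
  then show ?thesis by (simp add: hyper_def lshrink_def shrink_def image_image)
qed

lemma lrefines_imp: "lrefines K H \<Longrightarrow> hyper K \<sqsubseteq> hyper H"
  by (force simp: lrefines_def hyper_def refines_def)

text \<open>
  \<open>Dead\<close> claims that Staller wins at once, \<open>Goal\<close> that the target of the strategy is reached. In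
  \<open>Move w rs c\<close> Staller claims \<open>w\<close>, and \<open>rs\<close> lists replies of Dominator with Staller's
  continuations; replies hitting fewer edges than a listed one may be left out. On a board that
  is part of a larger position (\<open>lforces\<close>, with board \<open>V\<close>), \<open>c\<close> wins for Staller after a reply
  outside the board, using only edges inside it. The counter \<open>t\<close> is the number of replies so far.
\<close>

datatype strategy = Goal | Dead | Move int "(int \<times> strategy) list" strategy

fun forces :: "(nat \<Rightarrow> hyp \<Rightarrow> bool) \<Rightarrow> nat \<Rightarrow> hyp \<Rightarrow> strategy \<Rightarrow> bool" where
  "forces P t H Goal \<longleftrightarrow> P t H"
| "forces P t H Dead \<longleftrightarrow> (\<exists>e \<in> set H. length e \<le> 1)"
| "forces P t H (Move w rs c) \<longleftrightarrow>
    (let H' = lshrink w H in H \<noteq> [] \<and> rs \<noteq> [] \<and>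
      (\<forall>e \<in> set H'. \<forall>v \<in> set e. \<exists>r \<in> set rs. \<forall>e' \<in> set H'. v \<in> set e' \<longrightarrow> fst r \<in> set e') \<and>
      (\<forall>(v, c') \<in> set rs. forces P (Suc t) (lhit v H') c'))"

fun lforces :: "int list \<Rightarrow> (nat \<Rightarrow> hyp \<Rightarrow> bool) \<Rightarrow> nat \<Rightarrow> hyp \<Rightarrow> strategy \<Rightarrow> bool" where
  "lforces V P t H Goal \<longleftrightarrow> P t H"
| "lforces V P t H Dead \<longleftrightarrow> (\<exists>e \<in> set H. length e \<le> 1 \<and> set e \<subseteq> set V)"
| "lforces V P t H (Move w rs c) \<longleftrightarrow>
    (let H' = lshrink w H in w \<in> set V \<and>
      (\<forall>v \<in> set V. \<exists>r \<in> set rs. \<forall>e' \<in> set H'. v \<in> set e' \<longrightarrow> fst r \<in> set e') \<and>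
      (\<forall>(v, c') \<in> set rs. v \<in> set V \<and> lforces V P (Suc t) (lhit v H') c') \<and>
      forces (\<lambda>_ _. False) 0 (filter (\<lambda>e. set e \<subseteq> set V) H') c)"

section \<open>Soundness of Staller's strategies\<close>

lemma swin_image_iff:
  assumes "inj_on f (\<Union>H)"
  shows "swin k ((`) f ` H) \<longleftrightarrow> swin k H"
proof
  assume "swin k ((`) f ` H)"
  moreover have "inj_on (the_inv_into (\<Union>H) f) (\<Union>((`) f ` H))"
    using inj_on_the_inv_into[OF assms] by (simp add: image_Union)
  ultimately have "swin k ((`) (the_inv_into (\<Union>H) f) ` (`) f ` H)" by (rule swin_image)
  moreover have "the_inv_into (\<Union>H) f ` f ` e = e" if "e \<in> H" for e
  proof -
    have "the_inv_into (\<Union>H) f (f v) = v" if "v \<in> e" for v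
      using that \<open>e \<in> H\<close> assms by (intro the_inv_into_f_f) auto
    then show ?thesis by (simp add: image_image)
  qed
  ultimately show "swin k H" by (simp add: image_image)
qed (rule swin_image[OF _ assms])

lemma swin_no_small:
  assumes "swin k H" "e \<in> H"
  shows "\<not> e \<subseteq> {v}"
  using assms swin_no_single dwin_no_empty[OF swin_imp_dwin] by (metis subset_singletonD)

lemma swin_SucE:
  assumes "swin k H" "H \<noteq> {}"
  obtains l u where "k = Suc l" "swin l (hit u (shrink w H))"
proof (cases k)
  case 0
  then show ?thesis using assms by (simp add: swin_0)
next
  case (Suc l)
  then have "dwin (Suc l) (shrink w H)" using assms(1) by (simp add: swin_def)
  then show ?thesis using Suc that by (auto simp: dwin_Suc)
qed

text \<open>Each reply uses up one move of the budget, so replies made plus moves left never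
  increases. An unlisted reply hits no edge that some listed one misses, so replacing it only helps
  Dominator.\<close>

theorem forces_imp_swin:
  "forces P t H s \<Longrightarrow> swin k (hyper H) \<Longrightarrow>
    \<exists>t' H' l. P t' H' \<and> swin l (hyper H') \<and> t' + l \<le> t + k"
proof (induction P t H s arbitrary: k rule: forces.induct)
  case (1 P t H)
  then show ?case by auto
next
  case (2 P t H)
  then obtain e where e: "e \<in> set H" "length e \<le> 1" by auto
  from e(2) have "\<exists>v. set e \<subseteq> {v}" by (cases e) auto
  moreover have "set e \<in> hyper H" using e by (simp add: hyper_def)
  ultimately show ?case using swin_no_small 2(2) by metis
next
  case (3 P t H w rs c)
  let ?H = "lshrink w H"
  have "H \<noteq> []" and ne: "rs \<noteq> []"
    and dom: "\<And>e v. e \<in> set ?H \<Longrightarrow> v \<in> set e \<Longrightarrow>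
      \<exists>r \<in> set rs. \<forall>e' \<in> set ?H. v \<in> set e' \<longrightarrow> fst r \<in> set e'"
    and rs: "\<And>v c'. (v, c') \<in> set rs \<Longrightarrow> forces P (Suc t) (lhit v ?H) c'"
    using 3(2) by (auto simp: Let_def)
  then have "hyper H \<noteq> {}" by (simp add: hyper_def)
  with 3(3) obtain l u where l: "k = Suc l" "swin l (hit u (hyper ?H))"
    by (rule swin_SucE[where w = w]) (simp add: hyper_lshrink)
  obtain r where r: "r \<in> set rs" "\<forall>e' \<in> set ?H. u \<in> set e' \<longrightarrow> fst r \<in> set e'"
    using dom ne by (metis last_in_set)
  obtain v c' where v: "r = (v, c')" by force
  have "hyper (lhit v ?H) \<subseteq> hit u (hyper ?H)"
    using r(2) by (auto simp: hyper_def lhit_def hit_def v)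
  then have "swin l (hyper (lhit v ?H))"
    using l(2) refines_superset swin_mono by metis
  moreover have "forces P (Suc t) (lhit v ?H) c'" using rs r(1) v by simp
  ultimately show ?case using 3(1)[OF refl r(1) v[symmetric]] l(1) by fastforce
qed

text \<open>
  Integers outside the board \<open>V\<close> stand for sets of vertices of the larger position, and edges using
  an integer outside \<open>Q\<close> are absent from it.
\<close>

definition realize :: "(int \<Rightarrow> 'a set) \<Rightarrow> int set \<Rightarrow> hyp \<Rightarrow> 'a set set" where
  "realize W Q H = (\<lambda>e. \<Union>(W ` set e)) ` {e \<in> set H. set e \<subseteq> Q}"

text \<open>Under these conditions \<open>lhit\<close> and \<open>lshrink\<close> at an integer of
  the board act on \<open>realize\<close> exactly as claims of one vertex, and \<open>M\<close> is
  not affected.\<close>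

locale board =
  fixes W :: "int \<Rightarrow> 'a set" and Q :: "int set" and V :: "int list" and M :: "'a set set"
  assumes V: "set V \<subseteq> Q"
    and single: "\<And>v. v \<in> set V \<Longrightarrow> \<exists>a. W v = {a}"
    and disj: "\<And>v i. v \<in> set V \<Longrightarrow> i \<noteq> v \<Longrightarrow> W v \<inter> W i = {}"
    and fresh: "\<And>v. v \<in> set V \<Longrightarrow> W v \<inter> \<Union>M = {}"
begin

lemma realize_mem:
  assumes "v \<in> set V" "W v = {a}"
  shows "a \<in> \<Union>(W ` E) \<longleftrightarrow> v \<in> E"
proof -
  have "a \<in> W i \<longleftrightarrow> i = v" for i using disj[OF assms(1), of i] assms(2) by (cases "i = v") auto
  then show ?thesis by simp
qed

lemma realize_lhit:
  assumes "v \<in> set V" "W v = {a}"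
  shows "realize W Q (lhit v H) = hit a (realize W Q H)"
  unfolding realize_def lhit_def hit_def using realize_mem[OF assms] by auto

lemma realize_lshrink:
  assumes "v \<in> set V" "W v = {a}"
  shows "realize W Q (lshrink v H) = shrink a (realize W Q H)"
proof -
  have "a \<in> W i \<longleftrightarrow> i = v" for i using disj[OF assms(1), of i] assms(2) by (cases "i = v") auto
  then have "\<Union>(W ` (E - {v})) = \<Union>(W ` E) - {a}" for E using assms(2) by blast
  moreover have "{x \<in> E. x \<noteq> v} = E - {v}" for E by auto
  moreover have "set (filter (\<lambda>x. x \<noteq> v) e) \<subseteq> Q \<longleftrightarrow> set e \<subseteq> Q" for e
    using V assms(1) by auto
  then have "{e \<in> set (lshrink v H). set e \<subseteq> Q} =
      filter (\<lambda>x. x \<noteq> v) ` {e \<in> set H. set e \<subseteq> Q}"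
    by (simp only: lshrink_def set_map Compr_image_eq)
  ultimately show ?thesis by (simp add: realize_def shrink_def image_image)
qed

lemma swin_realize:
  assumes "swin k (realize W Q H)" and H: "\<And>e. e \<in> set H \<Longrightarrow> set e \<subseteq> set V"
  shows "swin k (hyper H)"
proof -
  have W: "W v = {the_elem (W v)}" if "v \<in> set V" for v
    using single[OF that] by (metis the_elem_eq)
  have inj: "inj_on (\<lambda>v. the_elem (W v)) (set V)"
  proof (rule inj_onI)
    fix u v
    assume "u \<in> set V" "v \<in> set V" "the_elem (W u) = the_elem (W v)"
    then have "W u = W v" "W u \<noteq> {}" using W by (metis, metis insert_not_empty)
    then show "u = v" using disj[of u v] \<open>u \<in> set V\<close> by auto
  qed
  have eq: "\<Union>(W ` E) = (\<lambda>v. the_elem (W v)) ` E" if "E \<subseteq> set V" for E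
  proof -
    have "\<Union>(W ` E) = (\<Union>v\<in>E. {the_elem (W v)})" using W that by (intro SUP_cong) auto
    then show ?thesis by auto
  qed
  have "realize W Q H = (`) (\<lambda>v. the_elem (W v)) ` hyper H"
  proof -
    have "{e \<in> set H. set e \<subseteq> Q} = set H" using V H by blast
    then show ?thesis using H eq by (simp add: realize_def hyper_def image_image)
  qed
  moreover have "\<Union>(hyper H) \<subseteq> set V" using H by (auto simp: hyper_def)
  ultimately show ?thesis using assms(1) inj inj_on_subset swin_image_iff by metis
qed

end

theorem lforces_imp_swin:
  "lforces V P t H s \<Longrightarrow> board W Q V M \<Longrightarrow> swin k (realize W Q H \<union> M) \<Longrightarrow>
    \<exists>t' H' l. P t' H' \<and> swin l (realize W Q H' \<union> M) \<and> t' + l \<le> t + k"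
proof (induction V P t H s arbitrary: k rule: lforces.induct)
  case (1 V P t H)
  then show ?case by auto
next
  case (2 V P t H)
  interpret board W Q V M by fact
  obtain e where e: "e \<in> set H" "length e \<le> 1" "set e \<subseteq> set V" using 2(1) by auto
  have "\<exists>a. \<Union>(W ` set e) \<subseteq> {a}"
  proof (cases e)
    case (Cons v e')
    then have "\<Union>(W ` set e) = W v" "v \<in> set V" using e by auto
    then show ?thesis using single by (metis order_refl)
  qed simp
  moreover have "\<Union>(W ` set e) \<in> realize W Q H \<union> M" using e V by (auto simp: realize_def)
  ultimately show ?case using swin_no_small 2(3) by metis
next
  case (3 V P t H w rs c)
  interpret board W Q V M by fact
  let ?H = "lshrink w H"
  let ?F = "filter (\<lambda>e. set e \<subseteq> set V) ?H"
  have w: "w \<in> set V"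
    and dom: "\<And>v. v \<in> set V \<Longrightarrow> \<exists>r \<in> set rs. \<forall>e' \<in> set ?H. v \<in> set e' \<longrightarrow> fst r \<in> set e'"
    and rs: "\<And>v c'. (v, c') \<in> set rs \<Longrightarrow> v \<in> set V \<and> lforces V P (Suc t) (lhit v ?H) c'"
    and c: "forces (\<lambda>_ _. False) 0 ?F c"
    using 3(2) by (auto simp: Let_def)
  \<comment> \<open>The target of \<open>c\<close> is \<open>False\<close>, so its branches can end
    only in \<open>Dead\<close>: no budget suffices against it.\<close>
  have lethal: "\<not> swin l (realize W Q ?F)" for l
  proof
    assume "swin l (realize W Q ?F)"
    then have "swin l (hyper ?F)" by (rule swin_realize) auto
    then show False using forces_imp_swin[OF c] by blast
  qed
  obtain a where a: "W w = {a}" using single[OF w] by blast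
  have shr: "shrink a (realize W Q H \<union> M) = realize W Q ?H \<union> M"
    using fresh[OF w] a by (simp add: shrink_Un shrink_fresh realize_lshrink[OF w a])
  have F_sub: "realize W Q ?F \<subseteq> realize W Q ?H" by (auto simp: realize_def)
  have "realize W Q H \<union> M \<noteq> {}"
  proof
    assume "realize W Q H \<union> M = {}"
    then have "realize W Q ?H = {}" using shr by (simp add: shrink_def)
    then have "swin 0 (realize W Q ?F)" using F_sub by (simp add: swin_0)
    then show False using lethal by blast
  qed
  with 3(4) obtain l u where l: "k = Suc l" "swin l (hit u (realize W Q ?H \<union> M))"
    by (rule swin_SucE[where w = a]) (simp add: shr)
  \<comment> \<open>A reply off the board hits none of the edges inside the board, and these alone
    are lethal.\<close>
  obtain v where v: "v \<in> set V" "W v = {u}"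
  proof (rule ccontr)
    assume no: "\<not> thesis"
    have "realize W Q ?F \<subseteq> hit u (realize W Q ?H \<union> M)"
    proof
      fix f assume f: "f \<in> realize W Q ?F"
      then obtain e where e: "f = \<Union>(W ` set e)" "set e \<subseteq> set V" by (auto simp: realize_def)
      have "u \<notin> f"
      proof
        assume "u \<in> f"
        then obtain v where "v \<in> set V" "u \<in> W v" using e by blast
        then show False using single[of v] that no by auto
      qed
      then show "f \<in> hit u (realize W Q ?H \<union> M)" using f F_sub by (auto simp: hit_def)
    qed
    then show False using l(2) lethal refines_superset swin_mono by metis
  qed
  obtain r where r: "r \<in> set rs" "\<forall>e' \<in> set ?H. v \<in> set e' \<longrightarrow> fst r \<in> set e'"
    using dom[OF v(1)] by blast
  obtain x c' where x: "r = (x, c')" by force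
  have xc: "x \<in> set V" "lforces V P (Suc t) (lhit x ?H) c'" using rs r(1) x by auto
  have "realize W Q (lhit x ?H) \<subseteq> realize W Q (lhit v ?H)"
    using r(2) by (auto simp: realize_def lhit_def x)
  moreover have "hit u (realize W Q ?H \<union> M) = realize W Q (lhit v ?H) \<union> M"
    using fresh[OF v(1)] v(2) by (simp add: hit_Un hit_fresh realize_lhit[OF v])
  ultimately have "swin l (realize W Q (lhit x ?H) \<union> M)"
    using l(2) by (metis Un_mono order_refl refines_superset swin_mono)
  then show ?case
    using 3(1)[OF refl r(1) x[symmetric] xc(2) 3(3)] l(1) by fastforce
qed

section \<open>Strategies of Staller on an arm\<close>

text \<open>Each target carries the number of replies that must have been made; for a strip this is
  the number of columns cleared.\<close>

definition reaches :: "(nat \<times> hyp) list \<Rightarrow> nat \<Rightarrow> hyp \<Rightarrow> bool" where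
  "reaches T t H \<longleftrightarrow> (\<exists>(j, K) \<in> set T. j \<le> t \<and> lrefines H K)"

text \<open>
  A strip of \<open>m\<close> columns of an arm: \<open>cell s q\<close> with \<open>s < m\<close> is a vertex of column \<open>s\<close>, while
  \<open>cell m q\<close> is what follows the strip in row \<open>q\<close>, and \<open>cell (Suc m) q\<close> is the rest of the closed
  neighbourhood of the vertex in column \<open>m\<close>. The first edge of \<open>strip m t q\<close> lacks its vertex in
  column \<open>t - 1\<close>.
\<close>

definition cell :: "nat \<Rightarrow> bool \<Rightarrow> int" where
  "cell s q = 2 * int s + of_bool q"

text \<open>Closed neighbourhood without the vertex in the preceding column. Past the strip it is
  collapsed to one integer, because no claim is made there.\<close>

definition head :: "nat \<Rightarrow> nat \<Rightarrow> bool \<Rightarrow> int list" where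
  "head m s q = (if s < m then [cell s False, cell s True, cell (Suc s) q] else [cell (Suc m) q])"

definition edge :: "nat \<Rightarrow> nat \<Rightarrow> bool \<Rightarrow> int list" where
  "edge m s q = (if s = 0 then [] else [cell (s - 1) q]) @ head m s q"

definition strip :: "nat \<Rightarrow> nat \<Rightarrow> bool \<Rightarrow> hyp" where
  "strip m t q = head m t q #
    concat (map (\<lambda>s. [edge m s False, edge m s True]) [Suc t..<Suc m])"

definition strip_ends :: "nat \<Rightarrow> (nat \<times> hyp) list" where
  "strip_ends m = concat (map (\<lambda>t. [(t, strip m t False), (t, strip m t True)]) [1..<Suc m])"

text \<open>The first claim, 2, reduces the short edge \<open>[0, 1, 2]\<close> to the two vertices
  of the first column.\<close>

definition row_strategy :: strategy where
  "row_strategy =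
    Move 2 [(0, Move 5 [(3, Goal), (4, Move 1 [(3, Goal), (6, Dead), (7, Dead)] Dead), (6, Move 3
    [(1, Move 7 [(4, Goal)] Dead), (7, Dead)] Dead), (7, Move 1 [(3, Move 6 [(4, Goal)] Dead), (6,
    Dead)] Dead)] (Move 3 [(1, Move 4 [(6, Dead), (7, Dead)] Dead), (4, Dead)] Dead)), (1, Move 4
    [(3, Goal), (5, Move 0 [(3, Goal), (6, Dead), (7, Dead)] Dead), (6, Move 3 [(0, Move 7 [(5,
    Goal)] Dead), (7, Dead)] Dead), (7, Move 0 [(3, Move 6 [(5, Goal)] Dead), (6, Dead)] Dead)]
    (Move 3 [(0, Move 5 [(6, Dead), (7, Dead)] Dead), (5, Dead)] Dead)), (3, Move 0 [(1, Goal),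
    (6, Dead), (7, Dead)] Dead), (4, Move 1 [(0, Move 5 [(3, Goal), (6, Dead), (7, Dead)] Dead),
    (5, Dead), (6, Dead), (7, Dead)] Dead), (5, Move 0 [(1, Move 4 [(3, Goal), (6, Dead), (7,
    Dead)] Dead), (4, Dead), (6, Dead), (7, Dead)] Dead), (6, Move 3 [(0, Move 5 [(1, Move 7 [(4,
    Goal)] Dead), (7, Dead)] Dead), (1, Move 4 [(0, Move 7 [(5, Goal)] Dead), (7, Dead)] Dead),
    (4, Move 1 [(0, Dead), (5, Dead), (7, Dead)] Dead), (5, Move 0 [(1, Dead), (4, Dead), (7,
    Dead)] Dead), (7, Move 0 [(1, Dead), (4, Dead)] Dead)] (Move 0 [(1, Dead), (4, Dead), (5,
    Dead)] Dead)), (7, Move 0 [(1, Move 4 [(3, Move 6 [(5, Goal)] Dead), (6, Dead)] Dead), (3,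
    Dead), (4, Dead), (5, Dead), (6, Dead)] Dead)] (Move 3 [(0, Move 5 [(1, Move 4 [(6, Dead), (7,
    Dead)] Dead), (4, Dead)] Dead), (1, Move 4 [(0, Move 5 [(6, Dead), (7, Dead)] Dead), (5,
    Dead)] Dead), (4, Move 1 [(0, Dead), (5, Dead)] Dead), (5, Move 0 [(1, Dead), (4, Dead)]
    Dead)] Dead)"

lemma row_forces: "lforces [0..7] (reaches (strip_ends 4)) 0 (strip 4 0 False) row_strategy"
  by code_simp

text \<open>Only at the outer end are both vertices of a column undominated. Claiming one corner
  leaves two edges of size 2 meeting in the other corner; the reply there leaves one undominated
  vertex in the next column.\<close>

definition full_strategy :: strategy where
  "full_strategy =
    Move 0 [(1, Goal), (2, Move 3 [(1, Goal)] Dead), (3, Move 2 [(1, Goal)] Dead)] (Move 1 [(2,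
    Dead), (3, Dead)] Dead)"

lemma full_forces:
  "lforces [0..3] (reaches (strip_ends 2)) 0 (head 2 0 True # strip 2 0 False) full_strategy"
  by code_simp

text \<open>
  The last \<open>l\<close> columns of an arm, with only the vertex of row \<open>b\<close> undominated in the first of them:
  0 is the vertex shared by the two arms, \<open>2 * s + 1\<close> and \<open>2 * s + 2\<close> are the vertices of column
  \<open>s\<close> in the rows \<open>False\<close> and \<open>True\<close>. The other arm uses the negative integers.
\<close>

definition tail :: "nat \<Rightarrow> bool \<Rightarrow> hyp" where
  "tail l b = [[],
    if b then [] else [[0, 1, 2]],
    if b then [[1, 2, 4], [0, 1, 3, 4]] else [[1, 2, 3], [0, 1, 3, 4]],
    if b then [[1, 2, 4], [1, 3, 4, 5], [2, 3, 4, 6], [0, 3, 5, 6]] else [[1, 2, 3], [1, 3, 4, 5],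
    [2, 3, 4, 6], [0, 3, 5, 6]]] ! l"

text \<open>A pair missing from the table gets \<open>Goal\<close>: either its bound holds without
  play, or the pair is listed in the other order.\<close>

definition tail_strategy :: "((nat \<times> bool) \<times> (nat \<times> bool)) \<Rightarrow> strategy" where
  "tail_strategy p = (case map_of [
    (((1, False), (3, False)), Move 0 [(1, Goal), (-3, Goal)] Dead),
    (((1, False), (3, True)), Move 0 [(1, Goal), (-3, Goal), (-4, Goal)] Dead),
    (((1, True), (3, False)), Move (-3) [(-1, Goal), (-2, Goal), (-4, Goal), (-5, Goal),
    (-6, Goal)] Dead),
    (((1, True), (3, True)), Move 0 [(-3, Goal), (-4, Goal)] Dead),
    (((2, False), (2, False)), Move 0 [(1, Goal), (-1, Goal)] Dead),
    (((2, False), (2, True)), Move 0 [(1, Goal), (-1, Goal)] Dead),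
    (((2, False), (3, False)), Move 1 [(0, Move 2 [(3, Goal), (-3, Goal)] Dead), (3, Move (-3)
    [(-1, Goal), (-2, Goal), (-4, Goal), (-5, Goal), (-6, Goal)] Dead), (-3, Move 3
    [(0, Goal), (2, Goal)] Dead)] Dead),
    (((2, False), (3, True)), Move 0 [(1, Move (-1) [(-3, Goal), (-4, Goal)] Dead), ((-3),
    Move 1 [(3, Goal), (-1, Goal)] Dead), (-4, Move 1 [(3, Goal), (-3, Goal)] Dead)] Dead),
    (((2, True), (2, True)), Move 0 [(1, Goal), (-1, Goal)] Dead),
    (((2, True), (3, False)), Move 1 [(0, Move 2 [(4, Goal), (-3, Goal)] Dead), (4, Move (-3)
    [(-1, Goal), (-2, Goal), (-4, Goal), (-5, Goal), (-6, Goal)] Dead), (-3, Move 4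
    [(0, Goal), (2, Goal)] Dead)] Dead),
    (((2, True), (3, True)), Move 0 [(1, Move (-1) [(-3, Goal), (-4, Goal)] Dead), (-3, Move
    1 [(4, Goal), (-1, Goal)] Dead), (-4, Move 1 [(4, Goal), (-3, Goal)] Dead)] Dead),
    (((3, False), (3, False)), Move 1 [(0, Move 2 [(3, Move (-3) [(-1, Goal), (-2, Goal),
    (-4, Goal)] Dead), (-3, Dead)] Dead), (3, Move (-3) [(-1, Move (-6) [(0, Goal), ((-2),
    Goal)] Dead), (-2, Move (-5) [(0, Goal), (-1, Goal)] Dead), (-4, Move 0 [(-1, Goal),
    (-5, Goal)] Dead), (-5, Move (-2) [(-1, Goal), (-4, Goal)] Dead), (-6, Move (-1)
    [(-2, Goal), (-4, Goal)] Dead)] Dead), (-3, Move 3 [(2, Move 5 [(0, Goal), (4, Goal)]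
    Dead), (4, Dead), (5, Dead), (6, Dead)] Dead)] Dead),
    (((3, False), (3, True)), Move (-4) [(0, Move (-1) [(3, Dead), (-2, Move 1 [(3, Goal),
    (-3, Goal)] Dead), (-3, Dead)] Dead), (3, Move (-3) [(-1, Move (-6) [(0, Goal), ((-2),
    Goal)] Dead), (-2, Move (-5) [(0, Goal), (-1, Goal)] Dead), (-5, Move (-2) [((-1),
    Goal), (-6, Goal)] Dead), (-6, Move (-1) [(-2, Goal), (-5, Goal)] Dead)] Dead), ((-1),
    Move (-3) [(0, Move 1 [(3, Goal), (-2, Goal)] Dead), (3, Move (-6) [(0, Goal), (-2, Goal)]
    Dead), (-6, Move 3 [(1, Goal), (2, Goal), (4, Goal), (5, Goal), (6, Goal)] Dead)] Dead),
    (-2, Move (-3) [(0, Move 1 [(3, Goal), (-1, Goal)] Dead), (3, Move (-5) [(0, Goal), ((-1),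
    Goal)] Dead), (-5, Move 3 [(1, Goal), (2, Goal), (4, Goal), (5, Goal), (6, Goal)] Dead)]
    Dead), (-3, Move (-1) [(3, Dead), (-2, Move 3 [(1, Goal), (2, Goal), (4, Goal), (5, Goal),
    (6, Goal)] Dead)] Dead)] Dead),
    (((3, True), (3, True)), Move 1 [(0, Move 2 [(4, Move (-4) [(-1, Goal), (-2, Goal), ((-3),
    Goal)] Dead), (-4, Dead)] Dead), (3, Move 2 [(4, Move 0 [(-3, Goal), (-4, Goal)] Dead),
    (-3, Dead), (-4, Dead)] Dead), (4, Move 0 [(3, Move (-1) [(-3, Goal), (-4, Goal)]
    Dead), (-3, Move 3 [(5, Goal), (-1, Goal)] Dead), (-4, Move 3 [(5, Goal), (-3, Goal)]
    Dead)] Dead), (-3, Move 2 [(3, Dead), (4, Move 0 [(3, Goal), (-1, Goal)] Dead), ((-1),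
    Dead)] Dead), (-4, Move 2 [(0, Dead), (3, Dead), (4, Move 0 [(3, Goal), (-3, Goal)] Dead)]
    Dead)] Dead)] p
    of None \<Rightarrow> Goal | Some c \<Rightarrow> c)"

text \<open>A nonempty position costs Dominator at least one more move, so play may stop one move
  short.\<close>

definition tail_goal where
  "tail_goal m t H \<longleftrightarrow> m \<le> t \<or> m = Suc t \<and> H \<noteq> []"

definition both_tails where
  "both_tails l b l' b' = tail l b @ map (map uminus) (tail l' b')"

definition "tail_types = [(0, False), (1, False), (1, True), (2, False), (2, True), (3, False), (3::nat, True)]"

definition tails_ok :: "nat \<times> bool \<Rightarrow> nat \<times> bool \<Rightarrow> bool" where
  "tails_ok p q \<longleftrightarrow>
    forces (tail_goal (fst p + fst q - 2)) 0 (both_tails (fst p) (snd p) (fst q) (snd q))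
      (tail_strategy (p, q))"

lemma tails_force:
  "\<forall>p \<in> set tail_types. \<forall>q \<in> set tail_types. tails_ok p q \<or> tails_ok q p"
  by code_simp

lemma realize_Cons:
  "realize W Q (e # H) = (if set e \<subseteq> Q then {\<Union>(W ` set e)} else {}) \<union> realize W Q H"
  by (auto simp: realize_def)

lemma realize_mono: "lrefines K H \<Longrightarrow> realize W Q K \<sqsubseteq> realize W Q H"
  unfolding refines_def
proof
  fix f assume "lrefines K H" "f \<in> realize W Q H"
  then obtain e d where "e \<in> set H" "set e \<subseteq> Q" "f = \<Union>(W ` set e)" "d \<in> set K" "set d \<subseteq> set e"
    by (fastforce simp: realize_def lrefines_def)
  then show "\<exists>d \<in> realize W Q K. d \<subseteq> f"
    by (intro bexI[of _ "\<Union>(W ` set d)"]) (auto simp: realize_def)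
qed

lemma cell_eq_iff: "cell s q = cell s' q' \<longleftrightarrow> s = s' \<and> q = q'"
  unfolding cell_def by (cases q; cases q') (simp_all, presburger+)

lemma cell_cases: "0 \<le> i \<Longrightarrow> \<exists>s q. i = cell s q"
  by (intro exI[of _ "nat (i div 2)"] exI[of _ "odd i"]) (auto simp: cell_def)

section \<open>Arms\<close>

text \<open>
  The columns of an arm are numbered from its outer end. Row \<open>True\<close> is the row of Dominator's first
  vertex, which therefore dominates the vertex of this row in the last column; \<open>x\<close> is the other
  vertex in the column of Dominator's first vertex.
\<close>

locale arm =
  fixes c :: "nat \<Rightarrow> bool \<Rightarrow> 'a" and L :: nat and x :: 'a
  assumes inj: "i < L \<Longrightarrow> i' < L \<Longrightarrow> c i b = c i' b' \<longleftrightarrow> i = i' \<and> b = b'"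
    and x_new: "i < L \<Longrightarrow> c i b \<noteq> x"
begin

text \<open>In the last column the next vertex is set to \<open>x\<close> in both rows. This is
  right only for row \<open>False\<close>; \<open>present\<close> discards the other row.\<close>

definition nb0 :: "bool \<Rightarrow> nat \<Rightarrow> 'a set" where
  "nb0 b i = {c i b, c i (\<not> b), if Suc i < L then c (Suc i) b else x}"

definition nb :: "bool \<Rightarrow> nat \<Rightarrow> 'a set" where
  "nb b i = nb0 b i \<union> (if i = 0 then {} else {c (i - 1) b})"

definition present :: "bool \<Rightarrow> nat \<Rightarrow> bool" where
  "present b i \<longleftrightarrow> i < L \<and> (Suc i = L \<longrightarrow> \<not> b)"

definition later :: "nat \<Rightarrow> 'a set set" where
  "later j = {nb b i | b i. j < i \<and> present b i}"

text \<open>A preceding vertex in row \<open>b\<close> counts as claimed by Staller, hence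
  \<open>nb0\<close> and not \<open>nb\<close>.\<close>

definition starting :: "nat \<Rightarrow> bool \<Rightarrow> 'a set set" where
  "starting j b = (if present b j then {nb0 b j} else {}) \<union> later j"

definition whole :: "'a set set" where
  "whole = {nb b i | b i. present b i}"

text \<open>The bit \<open>b\<close> exchanges the rows, so a strategy checked for one row serves
  both.\<close>

definition W :: "nat \<Rightarrow> nat \<Rightarrow> bool \<Rightarrow> int \<Rightarrow> 'a set" where
  "W m j b i = (let s = nat (i div 2); r = (b \<noteq> odd i) in
    if i < 0 then {}
    else if s < m then {c (j + s) r}
    else if s = m then {if j + m < L then c (j + m) r else x}
    else if s = Suc m \<and> j + m < L then nb0 r (j + m)
    else {})"

definition Q :: "nat \<Rightarrow> nat \<Rightarrow> bool \<Rightarrow> int set" where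
  "Q m j b = {cell s q | s q. s < m \<or> s = m \<and> present (b \<noteq> q) (j + m - 1) \<or>
    s = Suc m \<and> present (b \<noteq> q) (j + m)}"

lemma Union_later: "y \<in> \<Union>(later j) \<Longrightarrow> y = x \<or> (\<exists>i b. j \<le> i \<and> i < L \<and> y = c i b)"
proof -
  assume "y \<in> \<Union>(later j)"
  then obtain b i where y: "y \<in> nb b i" "j < i" "i < L"
    by (auto simp: later_def present_def)
  then have "y = c i b \<or> y = c i (\<not> b) \<or> y = (if Suc i < L then c (Suc i) b else x) \<or> y = c (i - 1) b"
    by (auto simp: nb_def nb0_def split: if_splits)
  moreover have "j \<le> i - 1" "i - 1 < L" "j \<le> Suc i" "j \<le> i" using y by auto
  ultimately show ?thesis using y(3) by metis
qed

lemma W_cell: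
  "W m j b (cell s q) = (if s < m then {c (j + s) (b \<noteq> q)}
    else if s = m then {if j + m < L then c (j + m) (b \<noteq> q) else x}
    else if s = Suc m \<and> j + m < L then nb0 (b \<noteq> q) (j + m)
    else {})"
proof -
  have "nat (cell s q div 2) = s" "odd (cell s q) \<longleftrightarrow> q" "\<not> cell s q < 0"
    by (auto simp: cell_def)
  then show ?thesis by (simp add: W_def Let_def)
qed

lemma cell_in_Q:
  "cell s q \<in> Q m j b \<longleftrightarrow> s < m \<or> s = m \<and> present (b \<noteq> q) (j + m - 1) \<or>
    s = Suc m \<and> present (b \<noteq> q) (j + m)"
  by (auto simp: Q_def cell_eq_iff)

lemma board:
  assumes m: "j + m \<le> L" and K: "\<And>i b. i < L \<Longrightarrow> c i b \<notin> \<Union>K"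
  shows "board (W m j b) (Q m j b) [0..2 * int m - 1] (later (j + m) \<union> K)"
proof
  have V: "\<exists>s q. v = cell s q \<and> s < m" if "v \<in> set [0..2 * int m - 1]" for v
    using that by (intro exI[of _ "nat (v div 2)"] exI[of _ "odd v"]) (auto simp: cell_def)
  show "set [0..2 * int m - 1] \<subseteq> Q m j b" using V by (fastforce simp: cell_in_Q)
  fix v assume "v \<in> set [0..2 * int m - 1]"
  then obtain s q where v: "v = cell s q" and s: "s < m" using V by blast
  let ?a = "c (j + s) (b \<noteq> q)"
  have Wv: "W m j b v = {?a}" using s by (simp add: v W_cell)
  then show "\<exists>a. W m j b v = {a}" by blast
  have l: "j + s < L" using s m by simp
  \<comment> \<open>Everything past the strip: it contains the sets of all integers off the board
    and all edges in \<open>later (j + m)\<close>, which reach back only to column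
    \<open>j + m\<close>.\<close>
  define S where "S = insert x {c i' b' | i' b'. j + m \<le> i' \<and> i' < L}"
  have S: "x \<in> S" "\<And>i' b'. j + m \<le> i' \<Longrightarrow> i' < L \<Longrightarrow> c i' b' \<in> S"
    by (auto simp: S_def)
  have a: "?a \<notin> S" using inj[OF l] x_new[OF l] s by (auto simp: S_def)
  show "W m j b v \<inter> W m j b i = {}" if "i \<noteq> v" for i
  proof (cases "i < 0")
    case True
    then show ?thesis by (simp add: W_def)
  next
    case False
    then obtain s' q' where i: "i = cell s' q'"
      using that by (metis cell_cases linorder_not_less)
    show ?thesis
    proof (cases "s' < m")
      case True
      then have "j + s' < L" using m by simp
      moreover have "s \<noteq> s' \<or> q \<noteq> q'" using that by (auto simp: v i cell_eq_iff)
      ultimately have "?a \<noteq> c (j + s') (b \<noteq> q')" using inj[OF l] by auto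
      then show ?thesis using True by (simp add: Wv i W_cell)
    next
      case False
      then have "W m j b i \<subseteq> S" using S by (auto simp: i W_cell nb0_def)
      then have "?a \<notin> W m j b i" using a by (rule contra_subsetD)
      then show ?thesis by (simp add: Wv)
    qed
  qed
  have "\<Union>(later (j + m)) \<subseteq> S" using Union_later[of _ "j + m"] unfolding S_def by blast
  then show "W m j b v \<inter> \<Union>(later (j + m) \<union> K) = {}" using a K[OF l] Wv by auto
qed

lemma realize_head:
  assumes "j + m \<le> L" "0 < m" "s \<le> m"
  shows "set (head m s q) \<subseteq> Q m j b \<longleftrightarrow> present (b \<noteq> q) (j + s)"
    and "present (b \<noteq> q) (j + s) \<Longrightarrow> \<Union>(W m j b ` set (head m s q)) = nb0 (b \<noteq> q) (j + s)"
proof -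
  show "set (head m s q) \<subseteq> Q m j b \<longleftrightarrow> present (b \<noteq> q) (j + s)"
  proof (cases "Suc s < m \<or> s = m")
    case True
    then show ?thesis using assms by (auto simp: head_def cell_in_Q present_def)
  next
    case False
    then have "m = Suc s" using assms by simp
    then show ?thesis by (auto simp: head_def cell_in_Q)
  qed
  assume "present (b \<noteq> q) (j + s)"
  then have l: "j + s < L" by (simp add: present_def)
  show "\<Union>(W m j b ` set (head m s q)) = nb0 (b \<noteq> q) (j + s)"
  proof (cases "s < m")
    case True
    have "W m j b (cell (Suc s) q) = {if Suc (j + s) < L then c (Suc (j + s)) (b \<noteq> q) else x}"
    proof (cases "Suc s < m")
      case False
      then have "m = Suc s" using True by simp
      then show ?thesis by (simp add: W_cell)
    qed (use assms in \<open>simp add: W_cell\<close>)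
    then show ?thesis using True by (cases b; cases q) (auto simp: head_def W_cell nb0_def)
  next
    case False
    then show ?thesis using assms l by (simp add: head_def W_cell)
  qed
qed

lemma realize_edge:
  assumes "j + m \<le> L" "0 < m" "0 < s" "s \<le> m"
  shows "set (edge m s q) \<subseteq> Q m j b \<longleftrightarrow> present (b \<noteq> q) (j + s)"
    and "present (b \<noteq> q) (j + s) \<Longrightarrow> \<Union>(W m j b ` set (edge m s q)) = nb (b \<noteq> q) (j + s)"
proof -
  have s: "s - 1 < m" using assms by simp
  then show "set (edge m s q) \<subseteq> Q m j b \<longleftrightarrow> present (b \<noteq> q) (j + s)"
    using realize_head(1)[OF assms(1,2,4)] by (simp add: edge_def cell_in_Q)
  assume "present (b \<noteq> q) (j + s)"
  note head = realize_head(2)[OF assms(1,2,4) this]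
  have "W m j b (cell (s - 1) q) = {c (j + s - 1) (b \<noteq> q)}"
    using s assms(3) by (simp add: W_cell)
  then show "\<Union>(W m j b ` set (edge m s q)) = nb (b \<noteq> q) (j + s)"
    using assms(3) by (simp add: edge_def nb_def head)
qed

text \<open>The rest \<open>later (j + m)\<close> does not depend on \<open>t\<close>, so this
  describes both the position before the forcing moves (\<open>t = 0\<close>) and every
  target.\<close>

lemma realize_strip:
  assumes m: "j + m \<le> L" "0 < m" "t \<le> m"
  shows "realize (W m j b) (Q m j b) (strip m t q) \<union> later (j + m) = starting (j + t) (b \<noteq> q)"
proof -
  let ?R = "realize (W m j b) (Q m j b)"
  have "?R (strip m t q) = (if present (b \<noteq> q) (j + t) then {nb0 (b \<noteq> q) (j + t)} else {}) \<union>
      {nb r (j + s) | r s. t < s \<and> s \<le> m \<and> present r (j + s)}" (is "_ = ?A \<union> ?B")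
  proof -
    let ?E = "concat (map (\<lambda>s. [edge m s False, edge m s True]) [Suc t..<Suc m])"
    have E: "set ?E = {edge m s q | s q. t < s \<and> s \<le> m}"
    proof -
      have "{edge m s False, edge m s True} = {edge m s q | q. True}" for s
        by (auto) (metis (full_types))+
      moreover have "set ?E = (\<Union>s\<in>{Suc t..m}. {edge m s False, edge m s True})"
        by (simp add: atLeastLessThanSuc_atLeastAtMost del: upt_Suc)
      ultimately show ?thesis by (auto simp: Suc_le_eq)
    qed
    have "?R ?E = ?B"
    proof (intro set_eqI iffI)
      fix f assume "f \<in> ?R ?E"
      then obtain s q' where s: "t < s" "s \<le> m" "set (edge m s q') \<subseteq> Q m j b"
        "f = \<Union>(W m j b ` set (edge m s q'))"
        unfolding realize_def E by blast
      then have p: "present (b \<noteq> q') (j + s)" using realize_edge(1)[OF m(1,2) _ s(2)] by simp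
      then have "f = nb (b \<noteq> q') (j + s)" using realize_edge(2)[OF m(1,2) _ s(2)] s by simp
      with p show "f \<in> ?B" using s(1,2) by blast
    next
      fix f assume "f \<in> ?B"
      then obtain r s where s: "t < s" "s \<le> m" "present r (j + s)" "f = nb r (j + s)" by blast
      have "r = (b \<noteq> (b \<noteq> r))" by auto
      then obtain q' where r: "r = (b \<noteq> q')" by blast
      have "set (edge m s q') \<subseteq> Q m j b"
        using realize_edge(1)[OF m(1,2) _ s(2), of q' b] s(1,3) r by simp
      moreover have "f = \<Union>(W m j b ` set (edge m s q'))"
        using realize_edge(2)[OF m(1,2) _ s(2), of b q'] s r by simp
      ultimately show "f \<in> ?R ?E" unfolding realize_def E using s(1,2) by blast
    qed
    moreover have "?R (strip m t q) = ?A \<union> ?R ?E"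
      using realize_head(1)[OF m, of q b] realize_head(2)[OF m, of b q]
      by (simp add: strip_def realize_Cons del: upt_Suc)
    ultimately show ?thesis by simp
  qed
  moreover have "later (j + t) = ?B \<union> later (j + m)"
  proof (intro set_eqI iffI)
    fix f assume "f \<in> later (j + t)"
    then obtain r i where i: "f = nb r i" "j + t < i" "present r i" by (auto simp: later_def)
    show "f \<in> ?B \<union> later (j + m)"
    proof (cases "i \<le> j + m")
      case True
      then have "f \<in> ?B" using i by (intro CollectI exI[of _ r] exI[of _ "i - j"]) auto
      then show ?thesis by simp
    next
      case False
      then show ?thesis using i by (auto simp: later_def)
    qed
  next
    fix f assume "f \<in> ?B \<union> later (j + m)"
    then have "\<exists>r i. f = nb r i \<and> j + t < i \<and> present r i"
    proof
      assume "f \<in> ?B"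
      then obtain r s where "f = nb r (j + s)" "t < s" "present r (j + s)" by blast
      then show ?thesis by (intro exI[of _ r] exI[of _ "j + s"]) simp
    next
      assume "f \<in> later (j + m)"
      then obtain r i where "f = nb r i" "j + m < i" "present r i" by (auto simp: later_def)
      then show ?thesis using m(3) by (intro exI[of _ r] exI[of _ i]) simp
    qed
    then show "f \<in> later (j + t)" by (auto simp: later_def)
  qed
  ultimately show ?thesis by (simp add: starting_def Un_assoc)
qed

text \<open>\<open>K\<close> stands for the other arm. It may contain \<open>x\<close>, which is
  never on the board.\<close>

lemma strip_step:
  assumes m: "j + m \<le> L" "0 < m" and K: "\<And>i b. i < L \<Longrightarrow> c i b \<notin> \<Union>K"
    and win: "swin k (realize (W m j b) (Q m j b) H \<union> (later (j + m) \<union> K))"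
    and forces: "lforces [0..2 * int m - 1] (reaches (strip_ends m)) 0 H s"
  shows "\<exists>t b' l. 0 < t \<and> swin l (starting (j + t) b' \<union> K) \<and> t + l \<le> k"
proof -
  obtain t' H' l where H': "reaches (strip_ends m) t' H'" "t' + l \<le> k"
      "swin l (realize (W m j b) (Q m j b) H' \<union> (later (j + m) \<union> K))"
    using lforces_imp_swin[OF forces board[OF m(1) K, of b] win] by auto
  then obtain t J where J: "(t, J) \<in> set (strip_ends m)" "t \<le> t'" "lrefines H' J"
    by (auto simp: reaches_def)
  then obtain q where t: "0 < t" "t \<le> m" "J = strip m t q" by (auto simp: strip_ends_def)
  have "realize (W m j b) (Q m j b) H' \<sqsubseteq> realize (W m j b) (Q m j b) J"
    using J(3) by (rule realize_mono)
  then have "realize (W m j b) (Q m j b) H' \<union> (later (j + m) \<union> K) \<sqsubseteq>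
      starting (j + t) (b \<noteq> q) \<union> K"
    unfolding realize_strip[OF m t(2), symmetric] t(3) Un_assoc
    by (rule refines_Un) (rule refines_superset, simp)
  then have "swin l (starting (j + t) (b \<noteq> q) \<union> K)" using H'(3) swin_mono by blast
  then show ?thesis using t(1) J(2) H'(2) by (meson add_le_mono1 le_trans)
qed

lemma row_step:
  assumes "j + 4 \<le> L" and K: "\<And>i b. i < L \<Longrightarrow> c i b \<notin> \<Union>K"
    and win: "swin k (starting j b \<union> K)"
  shows "\<exists>t b' l. 0 < t \<and> swin l (starting (j + t) b' \<union> K) \<and> t + l \<le> k"
proof (rule strip_step[OF assms(1) _ K])
  show "swin k (realize (W 4 j b) (Q 4 j b) (strip 4 0 False) \<union> (later (j + 4) \<union> K))"
    using win realize_strip[OF assms(1), of 0 b False] by (simp flip: Un_assoc)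
  show "lforces [0..2 * int 4 - 1] (reaches (strip_ends 4)) 0 (strip 4 0 False) row_strategy"
    using row_forces by simp
qed simp_all

lemma whole_step:
  assumes "2 \<le> L" and K: "\<And>i b. i < L \<Longrightarrow> c i b \<notin> \<Union>K"
    and win: "swin k (whole \<union> K)"
  shows "\<exists>t b' l. 0 < t \<and> swin l (starting t b' \<union> K) \<and> t + l \<le> k"
proof -
  have m: "0 + 2 \<le> L" using assms(1) by simp
  \<comment> \<open>Column 0 has no predecessor, so \<open>nb\<close> and \<open>nb0\<close> agree
    there; the full arm is a starting position with one extra edge.\<close>
  have "whole = insert (nb0 False 0) (starting 0 True)"
  proof -
    have "present r i \<longleftrightarrow> i = 0 \<or> 0 < i \<and> present r i" for r i
      using m by (cases i) (auto simp: present_def)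
    then have "whole = {nb r i | r i. i = 0 \<or> 0 < i \<and> present r i}"
      unfolding whole_def by (intro Collect_cong) metis
    then have "whole = {nb r 0 | r. True} \<union> later 0" by (auto simp: later_def)
    moreover have "{nb r 0 | r. True} = {nb0 False 0, nb0 True 0}"
      by (auto simp: nb_def) (metis (full_types))+
    ultimately show ?thesis using m by (auto simp: starting_def present_def)
  qed
  moreover have "present False 0" using m by (simp add: present_def)
  ultimately have *: "swin k (realize (W 2 0 True) (Q 2 0 True) (head 2 0 True # strip 2 0 False) \<union>
      (later (0 + 2) \<union> K))"
    using win realize_strip[OF m, of 0 True False] realize_head[OF m, of 0 True True]
    by (simp add: realize_Cons flip: Un_assoc)
  show ?thesis
    using strip_step[OF m _ K *] full_forces by simp
qed

end

section \<open>Sweeping one arm down to its last columns\<close>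

context arm
begin

lemma row_steps:
  assumes K: "\<And>i b. i < L \<Longrightarrow> c i b \<notin> \<Union>K" and "swin k (starting j b \<union> K)"
  shows "\<exists>j' b' l. L \<le> j' + 3 \<and> swin l (starting j' b' \<union> K) \<and> j' + l \<le> j + k"
  using assms(2)
proof (induction "L - j" arbitrary: j b k rule: less_induct)
  case less
  show ?case
  proof (cases "L \<le> j + 3")
    case False
    then have m: "j + 4 \<le> L" by simp
    obtain t b' l where t: "0 < t" "swin l (starting (j + t) b' \<union> K)" "t + l \<le> k"
      using row_step[OF m K less.prems] by blast
    have "L - (j + t) < L - j" using m t(1) by simp
    from less.hyps[OF this t(2)] show ?thesis using t(3) by fastforce
  qed (use less.prems in blast)
qed

lemma whole_steps:
  assumes K: "\<And>i b. i < L \<Longrightarrow> c i b \<notin> \<Union>K" and "swin k (whole \<union> K)"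
  shows "\<exists>j b l. L \<le> j + 3 \<and> swin l (starting j b \<union> K) \<and> j + l \<le> k"
proof -
  obtain t b l where t: "swin l (starting t b \<union> K)" "t + l \<le> k"
  proof (cases "2 \<le> L")
    case True
    then show ?thesis using whole_step[OF True K assms(2)] that by blast
  next
    case False
    \<comment> \<open>An arm of at most one column already has the required form, and no move is
      spent on it.\<close>
    have "later 0 \<subseteq> whole" unfolding later_def whole_def by blast
    moreover have "nb0 False 0 \<in> whole" if "present False 0"
    proof -
      have "nb0 False 0 = nb False 0" by (simp add: nb_def)
      then show ?thesis using that unfolding whole_def by blast
    qed
    ultimately have "starting 0 False \<subseteq> whole" by (simp add: starting_def)
    then have "swin k (starting 0 False \<union> K)"
      by (intro swin_mono[OF assms(2)] refines_superset) blast
    then show ?thesis using that[of k 0 False] by simp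
  qed
  then show ?thesis using row_steps[OF K t(1)] by fastforce
qed

lemma Union_starting: "\<Union>(starting j b) \<subseteq> insert x {c i r | i r. i < L}"
proof -
  have "nb0 b j \<subseteq> insert x {c i r | i r. i < L}" if "present b j"
    using that by (auto simp: nb0_def present_def)
  moreover have "\<Union>(later j) \<subseteq> insert x {c i r | i r. i < L}"
    using Union_later by blast
  ultimately show ?thesis by (auto simp: starting_def)
qed

lemma Union_whole: "\<Union>whole \<subseteq> insert x {c i r | i r. i < L}"
proof -
  have "nb r i \<subseteq> insert x {c i r | i r. i < L}" if "present r i" for r i
    using that by (auto simp: nb_def nb0_def present_def)
  then show ?thesis unfolding whole_def by blast
qed

lemma fresh:
  assumes "y \<noteq> x" "\<And>i r. i < L \<Longrightarrow> y \<noteq> c i r"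
  shows "y \<notin> \<Union>whole" and "y \<notin> \<Union>(starting j b)"
  using assms Union_whole Union_starting by blast+

text \<open>Membership is enough: dropping edges only favours Dominator, and a lower bound on his
  moves is sought.\<close>

lemma tail_edge:
  assumes l: "L \<le> j + 3" "l = L - j" and x: "g 0 = x"
    and c: "\<And>s r. s < l \<Longrightarrow> g (2 * int s + 1 + of_bool r) = c (j + s) r"
    and e: "e \<in> set (tail l b)"
  shows "g ` set e \<in> starting j b"
proof -
  have first: "E \<in> starting j b" if "E = nb0 b j" "present b j" for E
    using that by (simp add: starting_def)
  have later: "E \<in> starting j b" if "E = nb r i" "j < i" "present r i" for E r i
    using that unfolding starting_def later_def by blast
  consider "l = 0" | "l = 1" "L = j + 1" | "l = 2" "L = j + 2" | "l = 3" "L = j + 3"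
    using l by linarith
  then show ?thesis
  proof cases
    case 1
    then show ?thesis using e by (simp add: tail_def)
  next
    case 2
    then have g: "g 1 = c j False" "g 2 = c j True" using c[of 0 False] c[of 0 True] by simp_all
    have "\<not> b" "e = [0, 1, 2]" using e 2(1) by (simp_all add: tail_def split: if_splits)
    moreover have "\<not> Suc j < L" "Suc j = L" using 2 by simp_all
    ultimately show ?thesis by (intro first) (auto simp: g x nb0_def present_def)
  next
    case 3
    then have g: "g 1 = c j False" "g 2 = c j True" "g 3 = c (Suc j) False" "g 4 = c (Suc j) True"
      using c[of 0 False] c[of 0 True] c[of 1 False] c[of 1 True] by simp_all
    have L: "Suc j < L" "\<not> Suc (Suc j) < L" "Suc (Suc j) = L" using 3 by simp_all
    have "e = [1, 2, if b then 4 else 3] \<or> e = [0, 1, 3, 4]"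
      using e 3(1) by (auto simp: tail_def split: if_splits)
    then show ?thesis
    proof
      assume "e = [1, 2, if b then 4 else 3]"
      then show ?thesis using L by (intro first) (cases b; simp add: g nb0_def present_def insert_commute)+
    next
      assume "e = [0, 1, 3, 4]"
      moreover have "g ` set [0, 1, 3, 4] = nb False (Suc j)"
        using L by (auto simp: g x nb_def nb0_def)
      ultimately show ?thesis using L by (intro later[of _ False "Suc j"]) (simp_all add: present_def)
    qed
  next
    case 4
    then have g: "g 1 = c j False" "g 2 = c j True" "g 3 = c (Suc j) False" "g 4 = c (Suc j) True"
      "g 5 = c (Suc (Suc j)) False" "g 6 = c (Suc (Suc j)) True"
      using c[of 0 False] c[of 0 True] c[of 1 False] c[of 1 True] c[of 2 False] c[of 2 True]
      by simp_all
    have L: "Suc j < L" "Suc (Suc j) < L" "\<not> Suc (Suc (Suc j)) < L" "Suc (Suc (Suc j)) = L"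
      using 4 by simp_all
    have "e = [1, 2, if b then 4 else 3] \<or> e = [1, 3, 4, 5] \<or> e = [2, 3, 4, 6] \<or> e = [0, 3, 5, 6]"
      using e 4(1) by (auto simp: tail_def split: if_splits)
    then consider "e = [1, 2, if b then 4 else 3]" | "e = [1, 3, 4, 5]" | "e = [2, 3, 4, 6]"
      | "e = [0, 3, 5, 6]" by blast
    then show ?thesis
    proof cases
      case 1
      then show ?thesis using L by (intro first) (cases b; simp add: g nb0_def present_def insert_commute)+
    next
      case 2
      moreover have "g ` set [1, 3, 4, 5] = nb False (Suc j)"
        using L by (auto simp: g nb_def nb0_def)
      ultimately show ?thesis using L by (intro later[of _ False "Suc j"]) (simp_all add: present_def)
    next
      case 3
      moreover have "g ` set [2, 3, 4, 6] = nb True (Suc j)"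
        using L by (auto simp: g nb_def nb0_def)
      ultimately show ?thesis using L by (intro later[of _ True "Suc j"]) (simp_all add: present_def)
    next
      case 4
      moreover have "g ` set [0, 3, 5, 6] = nb False (Suc (Suc j))"
        using L by (auto simp: g x nb_def nb0_def)
      ultimately show ?thesis
        using L by (intro later[of _ False "Suc (Suc j)"]) (simp_all add: present_def)
    qed
  qed
qed

end

section \<open>The ends of both arms together\<close>

lemma hyper_both_tails:
  "hyper (both_tails l b l' b') = hyper (tail l b) \<union> (`) uminus ` hyper (tail l' b')"
  by (auto simp: both_tails_def hyper_def image_Un image_image)

lemma tails_bound_ok:
  assumes "tails_ok (l, b) (l', b')" "swin k (hyper (both_tails l b l' b'))"
  shows "l + l' \<le> k + 2"
proof -
  obtain t H i where H: "tail_goal (l + l' - 2) t H" "swin i (hyper H)" "t + i \<le> k"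
    using forces_imp_swin[OF assms(1)[unfolded tails_ok_def fst_conv snd_conv] assms(2)] by auto
  have "0 < i" if "H \<noteq> []"
  proof (rule ccontr)
    assume "\<not> 0 < i"
    then have "hyper H = {}" using H(2) by (simp add: swin_0)
    then show False using that by (simp add: hyper_def)
  qed
  then have "l + l' - 2 \<le> t + i" using H(1) by (auto simp: tail_goal_def)
  then show ?thesis using H(3) by simp
qed

lemma tails_bound:
  assumes "l \<le> 3" "l' \<le> 3" and win: "swin k (hyper (both_tails l b l' b'))"
  shows "l + l' \<le> k + 2"
proof -
  define r where "r = (b \<and> l \<noteq> 0)"
  define r' where "r' = (b' \<and> l' \<noteq> 0)"
  have tail_0: "tail 0 r = []" for r by (simp add: tail_def)
  have "tail l b = tail l r" "tail l' b' = tail l' r'"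
    by (cases "l = 0"; cases "l' = 0"; simp add: r_def r'_def tail_0)+
  then have win: "swin k (hyper (both_tails l r l' r'))"
    using win by (simp add: both_tails_def)
  have "(l, r) \<in> set tail_types" "(l', r') \<in> set tail_types"
    using assms(1,2) by (auto simp: tail_types_def r_def r'_def)
  then consider "tails_ok (l, r) (l', r')" | "tails_ok (l', r') (l, r)"
    using tails_force by blast
  then show ?thesis
  proof cases
    case 1
    then show ?thesis using win by (rule tails_bound_ok)
  next
    case 2
    \<comment> \<open>Negation fixes the shared vertex 0 and exchanges the arms, so one order of
      each pair suffices.\<close>
    have "(`) uminus ` hyper (both_tails l r l' r') = hyper (both_tails l' r' l r)"
      by (simp add: hyper_both_tails image_Un image_image Un_commute)
    then have "swin k (hyper (both_tails l' r' l r))" using swin_image[OF win, of uminus] by simp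
    then have "l' + l \<le> k + 2" by (rule tails_bound_ok[OF 2])
    then show ?thesis by simp
  qed
qed

lemma tail_bounds: "l \<le> 3 \<Longrightarrow> e \<in> set (tail l b) \<Longrightarrow> v \<in> set e \<Longrightarrow> 0 \<le> v \<and> v \<le> 2 * int l"
  by (subgoal_tac "l = 0 \<or> l = 1 \<or> l = 2 \<or> l = 3") (auto simp: tail_def split: if_splits)

text \<open>The arms are swept one after the other, each time with what is left of the other arm as
  the inert \<open>K\<close>.\<close>

theorem two_arms_bound:
  assumes "arm c L x" "arm d N x"
    and disj: "\<And>i b i' b'. i < L \<Longrightarrow> i' < N \<Longrightarrow> c i b \<noteq> d i' b'"
    and win: "swin k (arm.whole c L x \<union> arm.whole d N x)"
  shows "L + N \<le> k + 2"
proof -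
  interpret C: arm c L x by fact
  interpret D: arm d N x by fact
  have "c i b \<notin> \<Union>D.whole" if "i < L" for i b
    using C.x_new[OF that] disj[OF that] by (rule D.fresh)
  then obtain j b l where j: "L \<le> j + 3" "swin l (C.starting j b \<union> D.whole)" "j + l \<le> k"
    using C.whole_steps[OF _ win] by blast
  have "d i r \<notin> \<Union>(C.starting j b)" if "i < N" for i r
    using D.x_new[OF that] disj[OF _ that] by (intro C.fresh) metis+
  then obtain j' b' l' where j': "N \<le> j' + 3" "swin l' (D.starting j' b' \<union> C.starting j b)" "j' + l' \<le> l"
    using D.whole_steps[of "C.starting j b"] j(2) by (metis Un_commute)
  define m m' where "m = L - j" and "m' = N - j'"
  \<comment> \<open>Decoding of the tails: positive integers lie in the first arm, negative ones in
    the second, and 0 is shared.\<close>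
  define g where "g i = (if i = 0 then x
    else if 0 < i then c (j + nat ((i - 1) div 2)) (even i)
    else d (j' + nat ((- i - 1) div 2)) (even i))" for i :: int
  have g0: "g 0 = x" by (simp add: g_def)
  have gc: "g (2 * int s + 1 + of_bool r) = c (j + s) r" for s r by (cases r) (simp_all add: g_def)
  have gd: "g (- (2 * int s + 1 + of_bool r)) = d (j' + s) r" for s r
    by (cases r) (simp_all add: g_def)
  have ed: "g ` set (map uminus e) \<in> D.starting j' b'" if "e \<in> set (tail m' b')" for e
    using D.tail_edge[OF j'(1) m'_def, of "\<lambda>i. g (- i)" e b'] that gd g0
    by (simp add: image_image)
  have "(`) g ` hyper (both_tails m b m' b') \<subseteq> D.starting j' b' \<union> C.starting j b"
    using C.tail_edge[OF j(1) m_def g0 gc] ed by (auto simp: hyper_def both_tails_def)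
  then have "swin l' ((`) g ` hyper (both_tails m b m' b'))"
    by (rule swin_mono[OF j'(2) refines_superset])
  moreover have "inj_on g (\<Union>(hyper (both_tails m b m' b')))"
  proof (rule inj_on_subset)
    have m: "m \<le> 3" "m' \<le> 3" using j(1) j'(1) by (simp_all add: m_def m'_def)
    show "\<Union>(hyper (both_tails m b m' b')) \<subseteq> {- 2 * int m'..2 * int m}"
    proof
      fix v assume "v \<in> \<Union>(hyper (both_tails m b m' b'))"
      then obtain e where e: "e \<in> set (both_tails m b m' b')" "v \<in> set e"
        by (auto simp: hyper_def)
      then have "e \<in> set (tail m b) \<or> (\<exists>e' \<in> set (tail m' b'). - v \<in> set e')"
        by (auto simp: both_tails_def)
      then consider "e \<in> set (tail m b)" | e' where "e' \<in> set (tail m' b')" "- v \<in> set e'"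
        by blast
      then show "v \<in> {- 2 * int m'..2 * int m}"
      proof cases
        case 1
        then show ?thesis using tail_bounds[OF m(1) 1 e(2)] by simp
      next
        case 2
        then show ?thesis using tail_bounds[OF m(2) 2] by simp
      qed
    qed
    define P where "P s r = 2 * int s + 1 + of_bool r" for s r
    have split: "v = 0 \<or> (\<exists>s r. s < m \<and> v = P s r) \<or> (\<exists>s r. s < m' \<and> v = - P s r)"
      if "v \<in> {- 2 * int m'..2 * int m}" for v
    proof -
      have P: "u = P (nat ((u - 1) div 2)) (even u)" "u \<le> 2 * int m \<Longrightarrow> nat ((u - 1) div 2) < m"
        if "0 < u" for u m
        using that by (auto simp: P_def)
      consider "v = 0" | "0 < v" | "0 < - v" by linarith
      then show ?thesis
      proof cases
        case 2
        then show ?thesis using P(1)[OF 2] P(2)[OF 2, of m] that by auto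
      next
        case 3
        then have "v = - P (nat ((- v - 1) div 2)) (even (- v))" using P(1)[OF 3] by simp
        then show ?thesis using P(2)[OF 3, of m'] that by auto
      qed simp
    qed
    have g: "g (P s r) = c (j + s) r" "g (- P s r) = d (j' + s) r" for s r
      using gc gd by (simp_all add: P_def)
    have injs: "s < m \<Longrightarrow> s' < m \<Longrightarrow> c (j + s) r = c (j + s') r' \<longleftrightarrow> s = s' \<and> r = r'"
      "s < m' \<Longrightarrow> s' < m' \<Longrightarrow> d (j' + s) r = d (j' + s') r' \<longleftrightarrow> s = s' \<and> r = r'"
      "s < m \<Longrightarrow> c (j + s) r \<noteq> x" "s < m' \<Longrightarrow> d (j' + s) r \<noteq> x"
      "s < m \<Longrightarrow> s' < m' \<Longrightarrow> c (j + s) r \<noteq> d (j' + s') r'" for s s' r r'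
      using C.inj[of "j + s" "j + s'"] D.inj[of "j' + s" "j' + s'"] C.x_new[of "j + s"]
        D.x_new[of "j' + s"] disj[of "j + s" "j' + s'"]
      by (simp_all add: m_def m'_def less_diff_conv add.commute)
    show "inj_on g {- 2 * int m'..2 * int m}"
    proof (rule inj_onI)
      fix u v
      assume "u \<in> {- 2 * int m'..2 * int m}" "v \<in> {- 2 * int m'..2 * int m}" and eq: "g u = g v"
      from split[OF this(1)] split[OF this(2)] show "u = v"
        by (elim disjE exE conjE) (use eq injs injs(3-5)[symmetric] in \<open>simp_all add: g g0\<close>)
    qed
  qed
  ultimately have "swin l' (hyper (both_tails m b m' b'))" by (simp add: swin_image_iff)
  then have "m + m' \<le> l' + 2" using j(1) j'(1) by (intro tails_bound) (auto simp: m_def m'_def)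
  then show ?thesis using j(3) j'(3) by (simp add: m_def m'_def)
qed

section \<open>Checking strategies of Dominator\<close>

text \<open>
  \<open>Split V i p j q\<close> plays separately inside \<open>V\<close>, in at most \<open>i\<close> moves, and outside \<open>V\<close>, in at most
  \<open>j\<close> moves: an edge with at least two vertices in \<open>V\<close> is replaced by its part in \<open>V\<close>, any other
  one by its part outside. \<open>Known\<close> refers to the list \<open>K\<close> of positions already won, and a triple
  \<open>(w, v, p)\<close> of a \<open>Reply\<close> answers \<open>w\<close> by \<open>v\<close> and continues with \<open>p\<close>.
\<close>

datatype 'a plan =
    Pairs "('a \<times> 'a) list"
  | Known
  | Split "'a list" nat "'a plan" nat "'a plan"
  | Reply "('a \<times> 'a \<times> 'a plan) list"

fun succeeds :: "(nat \<times> hyp) list \<Rightarrow> nat \<Rightarrow> hyp \<Rightarrow> int plan \<Rightarrow> bool" where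
  "succeeds K k H (Pairs ps) \<longleftrightarrow>
    length ps \<le> k \<and> distinct (concat (map (\<lambda>(a, b). [a, b]) ps)) \<and>
    (\<forall>e \<in> set H. \<exists>(a, b) \<in> set ps. a \<in> set e \<and> b \<in> set e)"
| "succeeds K k H Known \<longleftrightarrow> (\<exists>(l, J) \<in> set K. l \<le> k \<and> lrefines J H)"
| "succeeds K k H (Split V i p j q) \<longleftrightarrow>
    i + j \<le> k \<and>
    succeeds K i (filter (\<lambda>e. 2 \<le> length e) (map (filter (\<lambda>v. v \<in> set V)) H)) p \<and>
    succeeds K j
      (map (filter (\<lambda>v. v \<notin> set V)) (filter (\<lambda>e. length (filter (\<lambda>v. v \<in> set V) e) < 2) H)) q"
| "succeeds K k H (Reply rs) \<longleftrightarrow>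
    rs \<noteq> [] \<and> 0 < k \<and>
    (\<forall>e \<in> set H. \<forall>w \<in> set e. \<exists>r \<in> set rs. fst r = w) \<and>
    (\<forall>(w, v, p) \<in> set rs. succeeds K (k - 1) (lhit v (lshrink w H)) p)"

theorem succeeds_imp_swin:
  "succeeds K k H p \<Longrightarrow> (\<And>l J. (l, J) \<in> set K \<Longrightarrow> swin l (hyper J)) \<Longrightarrow> swin k (hyper H)"
proof (induction K k H p rule: succeeds.induct)
  case (1 K k H ps)
  then have "swin (length ps) ((\<lambda>(a, b). {a, b}) ` set ps)" by (intro swin_pairs) simp
  then have "swin k ((\<lambda>(a, b). {a, b}) ` set ps)" by (rule swin_le_mono) (use 1 in simp)
  moreover have "(\<lambda>(a, b). {a, b}) ` set ps \<sqsubseteq> hyper H"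
    using 1 by (fastforce simp: refines_def hyper_def)
  ultimately show ?case by (rule swin_mono)
next
  case (2 K k H)
  then obtain l J where J: "(l, J) \<in> set K" "l \<le> k" "lrefines J H" by auto
  then show ?case using 2(2) swin_le_mono swin_mono lrefines_imp by blast
next
  case (3 K k H V i p j q)
  let ?A = "filter (\<lambda>e. 2 \<le> length e) (map (filter (\<lambda>v. v \<in> set V)) H)"
  let ?B = "map (filter (\<lambda>v. v \<notin> set V)) (filter (\<lambda>e. length (filter (\<lambda>v. v \<in> set V) e) < 2) H)"
  have "swin (i + j) (hyper ?A \<union> hyper ?B)"
  proof (rule swin_add)
    show "swin i (hyper ?A)" "swin j (hyper ?B)" using 3 by simp_all
    show "\<Union>(hyper ?A) \<inter> \<Union>(hyper ?B) = {}" by (auto simp: hyper_def)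
  qed
  then have "swin k (hyper ?A \<union> hyper ?B)" by (rule swin_le_mono) (use 3 in simp)
  moreover have "hyper ?A \<union> hyper ?B \<sqsubseteq> hyper H"
    unfolding refines_def
  proof
    fix e assume "e \<in> hyper H"
    then obtain d where d: "d \<in> set H" "e = set d" by (auto simp: hyper_def)
    show "\<exists>f \<in> hyper ?A \<union> hyper ?B. f \<subseteq> e"
    proof (cases "2 \<le> length (filter (\<lambda>v. v \<in> set V) d)")
      case True
      with d have "filter (\<lambda>v. v \<in> set V) d \<in> set ?A" by simp
      then have "set (filter (\<lambda>v. v \<in> set V) d) \<in> hyper ?A"
        unfolding hyper_def by (rule imageI)
      with d show ?thesis by (intro bexI[of _ "set (filter (\<lambda>v. v \<in> set V) d)"]) auto
    next
      case False
      with d have "filter (\<lambda>v. v \<notin> set V) d \<in> set ?B" by simp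
      then have "set (filter (\<lambda>v. v \<notin> set V) d) \<in> hyper ?B"
        unfolding hyper_def by (rule imageI)
      with d show ?thesis by (intro bexI[of _ "set (filter (\<lambda>v. v \<notin> set V) d)"]) auto
    qed
  qed
  ultimately show ?case by (rule swin_mono)
next
  case (4 K k H rs)
  then obtain k' where k: "k = Suc k'" by (auto simp: gr0_conv_Suc)
  have reply: "dwin k (shrink w (hyper H))" if "(w, v, p) \<in> set rs" for w v p
  proof -
    have "swin k' (hyper (lhit v (lshrink w H)))"
      using 4 that k by fastforce
    then show ?thesis by (auto simp: k dwin_Suc hyper_lhit hyper_lshrink)
  qed
  show ?case
    unfolding swin_def
  proof
    fix w
    show "dwin k (shrink w (hyper H))"
    proof (cases "w \<in> \<Union>(hyper H)")
      case True
      then obtain e where "e \<in> set H" "w \<in> set e" by (auto simp: hyper_def)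
      then obtain v p where "(w, v, p) \<in> set rs" using 4(2) by fastforce
      then show ?thesis by (rule reply)
    next
      case False
      \<comment> \<open>A claim outside all edges is a pass, so the answer to any listed claim shows
        that it is harmless.\<close>
      obtain w' v p where "(w', v, p) \<in> set rs" using 4(2) by (cases rs) auto
      then have "dwin k (shrink w' (hyper H))" by (rule reply)
      then have "dwin k (hyper H)" by (rule dwin_mono[OF _ shrink_refines])
      with False show ?thesis by (simp add: shrink_fresh)
    qed
  qed
qed

section \<open>The grid\<close>

text \<open>
  The columns 0 to 5 after Dominator's first move (0, 6): the vertex (r, j) is \<open>2 * j + r + 1\<close>, and
  (1, 6) is 0. Negation is the reflection in column 6.
\<close>

definition left_half :: hyp where
  "left_half =
    [[6, 7, 8, 10], [7, 9, 10, 11], [8, 9, 10, 12], [10, 11, 12, 0], [1, 2, 3], [1, 2, 4], [2, 3,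
    4, 6], [5, 7, 8, 9], [3, 5, 6, 7], [4, 5, 6, 8], [1, 3, 4, 5]]"

definition mirror :: "hyp \<Rightarrow> hyp" where
  "mirror H = map (map uminus) H"

definition left_plan :: "int plan" where
  "left_plan =
    Reply [(3, 6, Pairs [(1, 2), (4, 5), (7, 9), (10, 12)]), (4, 6, Pairs [(1, 2), (3, 5), (7, 9),
    (10, 12)]), (5, 3, Pairs [(7, 9), (6, 8), (10, 12), (1, 2)]), (6, 7, Pairs [(1, 2), (3, 4),
    (5, 8), (10, 12)]), (7, 6, Pairs [(10, 11), (8, 9), (1, 2), (3, 4)]), (8, 6, Pairs [(10, 12),
    (7, 9), (1, 2), (3, 4)]), (10, 7, Reply [(4, 12, Reply [(1, 2, Pairs [(3, 5), (6, 8)]), (2, 1,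
    Pairs [(3, 6), (5, 8)]), (3, 1, Pairs [(2, 6), (5, 8)]), (5, 1, Pairs [(6, 8), (2, 3)]), (6,
    1, Pairs [(5, 8), (2, 3)]), (8, 1, Pairs [(5, 6), (2, 3)])]), (1, 4, Pairs [(2, 3), (11, 12),
    (8, 9)]), (2, 4, Pairs [(1, 3), (11, 12), (8, 9)]), (3, 4, Pairs [(1, 2), (11, 12), (8, 9)]),
    (5, 4, Pairs [(11, 12), (8, 9), (1, 2)]), (6, 4, Pairs [(11, 12), (8, 9), (1, 2)]), (8, 4,
    Pairs [(9, 12), (11, 0), (1, 2)]), (12, 4, Pairs [(11, 0), (8, 9), (1, 2)]), (9, 4, Pairs [(8,
    12), (11, 0), (1, 2)]), (11, 4, Pairs [(12, 0), (8, 9), (1, 2)]), (0, 4, Pairs [(11, 12), (8,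
    9), (1, 2)])]), (1, 3, Pairs [(2, 4), (6, 8), (10, 12), (7, 9)]), (2, 3, Pairs [(1, 4), (6,
    8), (10, 12), (7, 9)]), (9, 7, Pairs [(10, 12), (1, 2), (3, 4), (5, 6)]), (11, 3, Pairs [(10,
    12), (7, 9), (6, 8), (1, 2)]), (12, 4, Pairs [(10, 11), (8, 9), (6, 7), (1, 2)]), (0, 3, Pairs
    [(10, 12), (6, 8), (7, 9), (1, 2)])]"

text \<open>These results settle the half that Staller's first claim spares; that half keeps the
  shared vertex 0.\<close>

lemma left_half_succeeds:
  "succeeds [] 5 left_half left_plan"
  "succeeds [] 5 (mirror left_half) (map_plan uminus left_plan)"
  by code_simp+

text \<open>The usual split is 4 moves for the half just attacked, without the vertex 0, and 5 for
  the other. The claims 0 and 10 need the uneven split of 3 and 6; the claim 10 is answered in the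
  other half, at its mirror image.\<close>

definition left_replies :: "(int \<times> int \<times> int plan) list" where
  "left_replies = (let left = [1..12] in
    [(0, 10, Split left 3 (Reply [(3, 5, Pairs [(1, 2), (4, 6)]), (4, 5, Pairs [(1, 2), (3, 6)]),
    (5, 3, Reply [(4, 8, Pairs [(1, 2)]), (8, 4, Pairs [(7, 9)]), (1, 4, Pairs [(7, 8)]), (2, 4,
    Pairs [(7, 8)]), (6, 4, Pairs [(7, 8)]), (7, 4, Pairs [(8, 9)]), (9, 4, Pairs [(7, 8)])]), (1,
    3, Pairs [(2, 4), (5, 8)]), (2, 3, Pairs [(1, 4), (5, 8)]), (6, 3, Pairs [(1, 2), (5, 8)]),
    (7, 3, Pairs [(5, 8), (1, 2)]), (8, 4, Pairs [(5, 7), (1, 2)]), (9, 3, Pairs [(5, 8), (1,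
    2)])]) 6 (Pairs [(-10, -11), (-6, -7), (-9, -12), (-5, -8), (-1, -2), (-3, -4)])), (1, 2,
    Split left 4 (Pairs [(10, 11), (6, 7), (8, 9), (4, 5)]) 5 Known), (2, 3, Split left 4 (Pairs
    [(1, 4), (10, 12), (6, 8), (7, 9)]) 5 Known), (3, 2, Split left 4 (Pairs [(10, 11), (6, 7),
    (8, 9), (4, 5)]) 5 Known), (4, 2, Split left 4 (Pairs [(10, 12), (6, 8), (7, 9), (3, 5)]) 5
    Known), (5, 3, Split left 4 (Pairs [(10, 12), (6, 8), (7, 9), (1, 2)]) 5 Known), (6, 7, Split
    left 4 (Pairs [(10, 12), (1, 2), (3, 4), (5, 8)]) 5 Known), (7, 6, Split left 4 (Pairs [(10,
    11), (8, 9), (1, 2), (3, 4)]) 5 Known), (8, 6, Split left 4 (Pairs [(10, 12), (7, 9), (1, 2),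
    (3, 4)]) 5 Known), (9, 7, Split left 4 (Pairs [(10, 12), (1, 2), (3, 4), (5, 6)]) 5 Known),
    (10, -10, Split (0 # left) 6 (Reply [(3, 6, Pairs [(1, 2), (4, 5), (11, 0), (7, 9), (8, 12)]),
    (4, 6, Pairs [(1, 2), (3, 5), (11, 0), (7, 9), (8, 12)]), (5, 6, Pairs [(11, 0), (7, 9), (8,
    12), (1, 2), (3, 4)]), (6, 7, Pairs [(11, 0), (9, 12), (1, 2), (3, 4), (5, 8)]), (7, 8, Pairs
    [(9, 11), (12, 0), (1, 2), (3, 4), (5, 6)]), (8, 7, Pairs [(9, 12), (11, 0), (1, 2), (3, 4),
    (5, 6)]), (1, 2, Reply [(5, 7, Pairs [(3, 4), (6, 8), (9, 12), (11, 0)]), (7, 8, Pairs [(9,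
    11), (12, 0), (3, 5)]), (8, 7, Pairs [(9, 12), (11, 0), (4, 5)]), (6, 7, Pairs [(11, 12), (8,
    9), (4, 5)]), (9, 7, Pairs [(8, 12), (11, 0), (3, 4), (5, 6)]), (3, 7, Pairs [(4, 5), (8, 9),
    (11, 12)]), (4, 8, Pairs [(3, 5), (11, 12), (7, 9)]), (11, 7, Pairs [(12, 0), (8, 9), (3, 4),
    (5, 6)]), (12, 7, Pairs [(11, 0), (8, 9), (3, 4), (5, 6)]), (0, 7, Pairs [(11, 12), (8, 9),
    (3, 4), (5, 6)])]), (2, 1, Reply [(6, 7, Pairs [(3, 4), (5, 8), (9, 12), (11, 0)]), (7, 8,
    Pairs [(9, 11), (12, 0), (3, 4), (5, 6)]), (8, 7, Pairs [(9, 12), (11, 0), (4, 5), (3, 6)]),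
    (5, 6, Pairs [(11, 0), (7, 9), (8, 12)]), (9, 7, Pairs [(8, 12), (11, 0), (3, 4), (5, 6)]),
    (3, 7, Pairs [(4, 6), (8, 9), (11, 12)]), (4, 8, Pairs [(3, 6), (11, 12), (7, 9)]), (11, 7,
    Pairs [(12, 0), (8, 9), (3, 4), (5, 6)]), (12, 7, Pairs [(11, 0), (8, 9), (3, 4), (5, 6)]),
    (0, 7, Pairs [(11, 12), (8, 9), (3, 4), (5, 6)])]), (9, 7, Pairs [(8, 12), (11, 0), (1, 2),
    (3, 4), (5, 6)]), (11, 7, Pairs [(12, 0), (8, 9), (1, 2), (3, 4), (5, 6)]), (12, 7, Pairs
    [(11, 0), (8, 9), (1, 2), (3, 4), (5, 6)]), (0, 7, Pairs [(11, 12), (8, 9), (1, 2), (3, 4),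
    (5, 6)])]) 3 (Reply [(-3, -5, Pairs [(-1, -2), (-4, -6)]), (-4, -5, Pairs [(-1, -2), (-3,
    -6)]), (-5, -3, Reply [(-4, -8, Pairs [(-1, -2)]), (-8, -4, Pairs [(-7, -9)]), (-1, -4, Pairs
    [(-7, -8)]), (-2, -4, Pairs [(-7, -8)]), (-6, -4, Pairs [(-7, -8)]), (-7, -4, Pairs [(-8,
    -9)]), (-9, -4, Pairs [(-7, -8)])]), (-1, -3, Pairs [(-2, -4), (-5, -8)]), (-2, -3, Pairs
    [(-1, -4), (-5, -8)]), (-6, -3, Pairs [(-1, -2), (-5, -8)]), (-7, -3, Pairs [(-5, -8), (-1,
    -2)]), (-8, -4, Pairs [(-5, -7), (-1, -2)]), (-9, -3, Pairs [(-5, -8), (-1, -2)])])), (11, 2,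
    Split left 4 (Pairs [(10, 12), (7, 9), (6, 8), (3, 5)]) 5 Known), (12, 2, Split left 4 (Pairs
    [(10, 11), (8, 9), (6, 7), (4, 5)]) 5 Known)])"

lemma left_replies_succeed:
  "\<forall>(w, v, p) \<in> set left_replies.
    succeeds [(5, left_half), (5, mirror left_half)] 9
      (lhit v (lshrink w (left_half @ mirror left_half))) p"
  by code_simp

lemma both_halves_move:
  assumes "w \<in> {0..12}"
  shows "dwin 10 (shrink w (hyper (left_half @ mirror left_half)))"
proof -
  have known: "swin l (hyper J)"
    if "(l, J) \<in> set [(5, left_half), (5, mirror left_half)]" for l J
    using that left_half_succeeds[THEN succeeds_imp_swin] by auto
  have "\<forall>w \<in> set [0..12]. \<exists>r \<in> set left_replies. fst r = w" by code_simp
  then obtain v p where r: "(w, v, p) \<in> set left_replies" using assms by fastforce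
  then have "succeeds [(5, left_half), (5, mirror left_half)] 9
      (lhit v (lshrink w (left_half @ mirror left_half))) p"
    using left_replies_succeed by blast
  then have "swin 9 (hyper (lhit v (lshrink w (left_half @ mirror left_half))))"
    by (rule succeeds_imp_swin) (rule known)
  then have "dwin (Suc 9) (shrink w (hyper (left_half @ mirror left_half)))"
    unfolding dwin_Suc hyper_lhit hyper_lshrink by blast
  then show ?thesis by simp
qed

lemma both_halves: "swin 10 (hyper (left_half @ mirror left_half))" (is "swin 10 ?H")
  unfolding swin_def
proof
  fix w :: int
  have out: "shrink w ?H = ?H" if "w \<notin> {- 12..12}"
  proof (rule shrink_fresh)
    have "\<forall>e \<in> set (left_half @ mirror left_half). \<forall>v \<in> set e. - 12 \<le> v \<and> v \<le> 12"
      by code_simp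
    then show "w \<notin> \<Union>?H" using that by (fastforce simp: hyper_def)
  qed
  have sym: "(`) uminus ` ?H = ?H"
    by (simp add: hyper_def mirror_def image_Un image_image Un_commute)
  consider "w \<in> {0..12}" | "- w \<in> {0..12}" | "w \<notin> {- 12..12}" by fastforce
  then show "dwin 10 (shrink w ?H)"
  proof cases
    case 2
    \<comment> \<open>The position is its own mirror image, so a claim at \<open>w\<close> is a
      reflected claim at \<open>- w\<close>.\<close>
    have "dwin 10 ((`) uminus ` shrink (- w) ?H)" by (intro dwin_image both_halves_move 2) simp
    moreover have "(`) uminus ` shrink (- w) ?H = shrink w ((`) uminus ` ?H)"
    proof -
      have "uminus ` (e - {- w}) = uminus ` e - {w}" for e by force
      then show ?thesis by (simp add: shrink_def image_image)
    qed
    ultimately show ?thesis by (simp add: sym)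
  next
    case 3
    have "dwin 10 ?H" by (rule dwin_mono[OF both_halves_move[of 0] shrink_refines]) simp
    then show ?thesis by (simp add: out[OF 3])
  qed (rule both_halves_move)
qed

section \<open>Coordinates of the grid and the upper bound\<close>

abbreviation grid :: "nat \<Rightarrow> (nat \<times> nat) pair_pre_digraph" where
  "grid n \<equiv> path_graph 2 \<box> path_graph n"

lemma pverts_grid: "pverts (grid n) = {..<2} \<times> {..<n}"
  by (simp add: cartesian_product_def path_graph_def)

lemma parcs_grid_wf: "(v, u) \<in> parcs (grid n) \<Longrightarrow> u \<in> pverts (grid n)"
  by (auto simp: cartesian_product_def path_graph_def)

text \<open>Closed adjacency without the bounds of the grid, so that the finite checks do not
  involve \<open>n\<close>.\<close>

definition near :: "nat \<times> nat \<Rightarrow> nat \<times> nat \<Rightarrow> bool" where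
  "near v u \<longleftrightarrow> snd v = snd u \<or> fst v = fst u \<and> (snd u = Suc (snd v) \<or> snd v = Suc (snd u))"

lemma closed_nbh_grid:
  assumes "v \<in> pverts (grid n)"
  shows "closed_nbh (grid n) v = {u \<in> pverts (grid n). near v u}"
proof -
  obtain r i where v: "v = (r, i)" by force
  have "r = 0 \<or> r = 1" using assms by (auto simp: v pverts_grid)
  then show ?thesis
    using assms
    by (auto simp: v closed_nbh_def near_def cartesian_product_def path_graph_def less_2_cases_iff)
qed

lemma closed_nbh_grid_bounds:
  assumes "v \<in> pverts (grid n)"
  shows "closed_nbh (grid n) v = {u. fst u < 2 \<and> snd u < n \<and> near v u}"
  unfolding closed_nbh_grid[OF assms] by (simp add: pverts_grid mem_Times_iff conj_assoc)

definition place :: "int \<Rightarrow> nat \<times> nat" where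
  "place i = (if i = 0 then (1, 6)
    else if 0 < i then (nat ((i - 1) mod 2), nat ((i - 1) div 2))
    else (nat ((- i - 1) mod 2), 12 - nat ((- i - 1) div 2)))"

lemma inj_place: "inj_on place {- 12..12}"
proof -
  have "distinct (map place [- 12..12])" by code_simp
  then show ?thesis by (simp only: distinct_map set_upto)
qed

text \<open>Inclusion is what survives for every \<open>n\<close>: if \<open>n > 13\<close>, a
  vertex of column 12 has a further neighbour in column 13, which its edge here lacks.\<close>

lemma place_covers:
  "\<forall>j \<in> set [0..<13]. \<forall>r \<in> set [0, 1]. near (r, j) (0, 6) \<or>
    (\<exists>e \<in> set (left_half @ mirror left_half). \<forall>i \<in> set e. near (r, j) (place i))"
  by code_simp

lemma place_bounds:
  "\<forall>e \<in> set (left_half @ mirror left_half). \<forall>i \<in> set e.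
    - 12 \<le> i \<and> i \<le> 12 \<and> fst (place i) < 2 \<and> snd (place i) < 13"
  by code_simp

lemma grid_upper:
  assumes n: "13 \<le> n"
  shows "dwin (n - 2) (closed_nbh (grid n) ` pverts (grid n))"
proof -
  let ?E = "closed_nbh (grid n) ` pverts (grid n)"
  let ?H = "hyper (left_half @ mirror left_half)"
  \<comment> \<open>A column lies in the closed neighbourhoods of both of its vertices, so one pair
    serves both.\<close>
  define ps :: "((nat \<times> nat) \<times> (nat \<times> nat)) list" where
    "ps = map (\<lambda>j. ((0, j), (1, j))) [13..<n]"
  have "distinct (concat (map (\<lambda>j. [(0 :: nat, j), (1 :: nat, j)]) [a..<b]))" for a b :: nat
    by (induction b) auto
  then have "swin (n - 13) ((\<lambda>(a, b). {a, b}) ` set ps)"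
    using swin_pairs[of ps] by (simp add: ps_def comp_def)
  moreover have "swin 10 ((`) place ` ?H)"
  proof (rule swin_image[OF both_halves])
    show "inj_on place (\<Union>?H)"
      by (rule inj_on_subset[OF inj_place]) (use place_bounds in \<open>fastforce simp: hyper_def\<close>)
  qed
  moreover have "\<Union>((`) place ` ?H) \<inter> \<Union>((\<lambda>(a, b). {a, b}) ` set ps) = {}"
  proof -
    have "snd v < 13" if "v \<in> \<Union>((`) place ` ?H)" for v
      using that place_bounds by (fastforce simp: hyper_def)
    moreover have "13 \<le> snd v" if "v \<in> \<Union>((\<lambda>(a, b). {a, b}) ` set ps)" for v
      using that by (auto simp: ps_def)
    ultimately show ?thesis unfolding disjoint_iff by (meson not_less)
  qed
  ultimately have "swin (10 + (n - 13)) ((`) place ` ?H \<union> (\<lambda>(a, b). {a, b}) ` set ps)"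
    by (intro swin_add)
  moreover have "(`) place ` ?H \<union> (\<lambda>(a, b). {a, b}) ` set ps \<sqsubseteq> hit (0, 6) ?E"
    unfolding refines_def
  proof
    fix e assume "e \<in> hit (0, 6) ?E"
    then obtain v where v: "v \<in> pverts (grid n)" "e = closed_nbh (grid n) v" "(0, 6) \<notin> e"
      by (auto simp: hit_def)
    obtain r j where rj: "v = (r, j)" "r = 0 \<or> r = 1" "j < n"
      using v(1) by (cases v) (auto simp: pverts_grid dest: less_2_cases)
    have e: "e = {u. fst u < 2 \<and> snd u < n \<and> near (r, j) u}"
      using closed_nbh_grid_bounds[OF v(1)] by (simp add: v(2) rj(1))
    show "\<exists>f \<in> (`) place ` ?H \<union> (\<lambda>(a, b). {a, b}) ` set ps. f \<subseteq> e"
    proof (cases "j < 13")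
      case True
      have "\<not> near (r, j) (0, 6)" using v(3) n by (simp add: e)
      then obtain d where d: "d \<in> set (left_half @ mirror left_half)" "\<forall>i \<in> set d. near (r, j) (place i)"
        using place_covers True rj(2) by fastforce
      then have "place ` set d \<subseteq> e" using place_bounds n by (fastforce simp: e)
      moreover have "place ` set d \<in> (`) place ` ?H" unfolding hyper_def using d(1) by blast
      ultimately show ?thesis by (rule bexI[OF _ UnI1])
    next
      case False
      then have "((0, j), (1, j)) \<in> set ps" using rj(3) by (auto simp: ps_def)
      then have "(case ((0, j), (1, j)) of (a, b) \<Rightarrow> {a, b}) \<in> (\<lambda>(a, b). {a, b}) ` set ps"
        by (rule imageI)
      moreover have "{(0, j), (1, j)} \<subseteq> e" using rj(3) by (simp add: e near_def)
      ultimately show ?thesis by (intro bexI[of _ "{(0, j), (1, j)}"]) simp_all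
    qed
  qed
  ultimately have "swin (10 + (n - 13)) (hit (0, 6) ?E)" by (rule swin_mono)
  then have "dwin (Suc (10 + (n - 13))) ?E" unfolding dwin_Suc by blast
  moreover have "Suc (10 + (n - 13)) = n - 2" using n by simp
  ultimately show ?thesis by (simp only:)
qed

section \<open>The arms of the grid and the lower bound\<close>

lemma closed_nbh_grid_eq:
  assumes "r < 2" "p < n"
  shows "closed_nbh (grid n) (r, p) = {(r, p), (1 - r, p)} \<union>
    (if p = 0 then {} else {(r, p - 1)}) \<union> (if Suc p < n then {(r, Suc p)} else {})"
proof -
  have v: "(r, p) \<in> pverts (grid n)" using assms by (simp add: pverts_grid)
  have "r = 0 \<or> r = 1" using assms(1) by auto
  then have row: "a < 2 \<longleftrightarrow> a = r \<or> a = 1 - r" for a by auto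
  have "(fst u < 2 \<and> snd u < n \<and> near (r, p) u) \<longleftrightarrow> u = (r, p) \<or> u = (1 - r, p) \<or>
      p \<noteq> 0 \<and> u = (r, p - 1) \<or> Suc p < n \<and> u = (r, Suc p)" for u
    using assms(2) by (cases u) (auto simp: near_def row)
  then show ?thesis unfolding closed_nbh_grid_bounds[OF v] by auto
qed

text \<open>Both numberings run towards column \<open>i\<close>, hence the reversal
  \<open>n - 1 - m\<close> on the right. The vertex \<open>(1 - r, i)\<close> is dominated by the
  first move and adds no edge.\<close>

lemma grid_arms:
  assumes "r < 2" "i < n"
  defines "c \<equiv> \<lambda>m b. (if b then r else 1 - r, m)"
    and "d \<equiv> \<lambda>m b. (if b then r else 1 - r, n - 1 - m)"
  shows "arm c i (1 - r, i)" "arm d (n - 1 - i) (1 - r, i)"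
    "arm.whole c i (1 - r, i) \<subseteq> hit (r, i) (closed_nbh (grid n) ` pverts (grid n))"
    "arm.whole d (n - 1 - i) (1 - r, i) \<subseteq> hit (r, i) (closed_nbh (grid n) ` pverts (grid n))"
proof -
  have r: "r = 0 \<or> r = 1" using assms by auto
  show C: "arm c i (1 - r, i)" and D: "arm d (n - 1 - i) (1 - r, i)"
    using r by (unfold_locales; auto simp: c_def d_def)+
  interpret C: arm c i "(1 - r, i)" by fact
  interpret D: arm d "n - 1 - i" "(1 - r, i)" by fact
  have row: "(if \<not> b then r else 1 - r) = 1 - (if b then r else 1 - r)"
    "(if b then r else 1 - r) < 2" for b
    using r by auto
  have r': "1 - r \<noteq> r" using r by auto
  have nbC: "C.nb b m = closed_nbh (grid n) (c m b) \<and> (r, i) \<notin> C.nb b m \<and> c m b \<in> pverts (grid n)"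
    if "C.present b m" for b m
  proof -
    define q where "q = (if b then r else 1 - r)"
    have q: "q < 2" "Suc m = i \<Longrightarrow> q = 1 - r" "m < i"
      using that row(2)[of b] by (auto simp: q_def C.present_def)
    have cs: "c k b = (q, k)" "c k (\<not> b) = (1 - q, k)" for k
      using row(1)[of b] by (simp_all add: c_def q_def)
    have nb: "C.nb b m = {(q, m), (1 - q, m), if Suc m < i then (q, Suc m) else (1 - r, i)} \<union>
        (if m = 0 then {} else {(q, m - 1)})"
      unfolding C.nb_def C.nb0_def cs by simp
    have N: "closed_nbh (grid n) (q, m) = {(q, m), (1 - q, m), (q, Suc m)} \<union>
        (if m = 0 then {} else {(q, m - 1)})"
      using closed_nbh_grid_eq[OF q(1), of m n] q(3) assms(2) by (auto simp: insert_commute)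
    show ?thesis
    proof (cases "Suc m < i")
      case True
      then show ?thesis
        unfolding nb N cs using q assms(2) by (auto simp: pverts_grid)
    next
      case False
      then have "Suc m = i" using q(3) by simp
      then show ?thesis
        unfolding nb N cs using q assms(2) r' by (auto simp: pverts_grid)
    qed
  qed
  show "C.whole \<subseteq> hit (r, i) (closed_nbh (grid n) ` pverts (grid n))"
  proof
    fix e assume "e \<in> C.whole"
    then obtain b m where "e = C.nb b m" "C.present b m" unfolding C.whole_def by blast
    then have "e = closed_nbh (grid n) (c m b)" "(r, i) \<notin> e" "c m b \<in> pverts (grid n)"
      using nbC by metis+
    then show "e \<in> hit (r, i) (closed_nbh (grid n) ` pverts (grid n))"
      by (simp add: hit_def)
  qed
  have nbD: "D.nb b m = closed_nbh (grid n) (d m b) \<and> (r, i) \<notin> D.nb b m \<and> d m b \<in> pverts (grid n)"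
    if "D.present b m" for b m
  proof -
    define q where "q = (if b then r else 1 - r)"
    have pres: "m < n - 1 - i" "Suc m = n - 1 - i \<Longrightarrow> \<not> b"
      using that unfolding D.present_def by blast+
    define p where "p = n - 1 - m"
    have p: "i < p" "p < n" and q: "q < 2" "p = Suc i \<Longrightarrow> q = 1 - r"
      using pres assms(2) row(2)[of b] by (auto simp: p_def q_def)
    have ds: "d k b = (q, n - 1 - k)" "d k (\<not> b) = (1 - q, n - 1 - k)" for k
      using row(1)[of b] by (simp_all add: d_def q_def)
    have ps: "Suc m < n - 1 - i \<longleftrightarrow> Suc i < p" "n - 1 - Suc m = p - 1" "m = 0 \<longleftrightarrow> \<not> Suc p < n"
      "m \<noteq> 0 \<Longrightarrow> n - 1 - (m - 1) = Suc p" "n - 1 - m = p"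
      using pres assms(2) by (auto simp: p_def)
    have nb: "D.nb b m = {(q, p), (1 - q, p), if Suc i < p then (q, p - 1) else (1 - r, i)} \<union>
        (if Suc p < n then {(q, Suc p)} else {})"
      unfolding D.nb_def D.nb0_def ds ps(1,2,5) using ps(3,4) by simp
    have N: "closed_nbh (grid n) (q, p) = {(q, p), (1 - q, p), (q, p - 1)} \<union>
        (if Suc p < n then {(q, Suc p)} else {})"
      unfolding closed_nbh_grid_eq[OF q(1) p(2)] using p(1) by auto
    show ?thesis
    proof (cases "Suc i < p")
      case True
      then show ?thesis
        unfolding nb N ds ps(5) using q p by (auto simp: pverts_grid)
    next
      case False
      then have "p = Suc i" using p(1) by simp
      then show ?thesis
        unfolding nb N ds ps(5) using q p r' by (auto simp: pverts_grid)
    qed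
  qed
  show "D.whole \<subseteq> hit (r, i) (closed_nbh (grid n) ` pverts (grid n))"
  proof
    fix e assume "e \<in> D.whole"
    then obtain b m where "e = D.nb b m" "D.present b m" unfolding D.whole_def by blast
    then have "e = closed_nbh (grid n) (d m b)" "(r, i) \<notin> e" "d m b \<in> pverts (grid n)"
      using nbD by metis+
    then show "e \<in> hit (r, i) (closed_nbh (grid n) ` pverts (grid n))"
      by (simp add: hit_def)
  qed
qed

lemma grid_lower:
  assumes win: "dwin k (closed_nbh (grid n) ` pverts (grid n))"
  shows "n - 2 \<le> k"
proof (cases "n = 0")
  case False
  let ?E = "closed_nbh (grid n) ` pverts (grid n)"
  have v0: "(0, 0) \<in> pverts (grid n)" using False by (simp add: pverts_grid)
  then have "?E \<noteq> {}" by blast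
  then obtain l v where l: "k = Suc l" "swin l (hit v ?E)"
    using win by (cases k) (auto simp: dwin_Suc)
  obtain r i where ri: "r < 2" "i < n" "swin l (hit (r, i) ?E)"
  proof (cases "v \<in> pverts (grid n)")
    case True
    then show ?thesis using that[of "fst v" "snd v"] l(2) by (auto simp: pverts_grid)
  next
    case False
    \<comment> \<open>A first move outside the grid is a pass; any vertex of the grid is at least as
      good for Dominator.\<close>
    have "hit v ?E = ?E" using False closed_nbh_grid by (intro hit_fresh) blast
    then have "swin l (hit (0, 0) ?E)" using l(2) swin_mono[OF _ refines_hit_same] by simp
    moreover have "0 < n" using v0 by (simp add: pverts_grid)
    ultimately show ?thesis by (intro that[of 0 0]) simp_all
  qed
  note arms = grid_arms[OF ri(1,2)]
  have "i + (n - 1 - i) \<le> l + 2"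
  proof (rule two_arms_bound[OF arms(1,2)])
    show "swin l (arm.whole (\<lambda>m b. (if b then r else 1 - r, m)) i (1 - r, i) \<union>
        arm.whole (\<lambda>m b. (if b then r else 1 - r, n - 1 - m)) (n - 1 - i) (1 - r, i))"
      using arms(3,4) by (intro swin_mono[OF ri(3)] refines_superset) simp
  qed auto
  then show ?thesis using ri(2) l(1) by simp
qed simp

theorem theorem5:
  fixes n :: nat
  assumes "n \<ge> 13"
  shows "gamma_MB (path_graph 2 \<box> path_graph n) = enat (n - 2)"
proof -
  have iff: "D_to_move (grid n) k {} {} \<longleftrightarrow> dwin k (closed_nbh (grid n) ` pverts (grid n))" for k
    using parcs_grid_wf by (rule D_to_move_iff)
  have "Inf {enat k | k. D_to_move (grid n) k {} {}} = enat (n - 2)"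
  proof (rule antisym)
    show "Inf {enat k | k. D_to_move (grid n) k {} {}} \<le> enat (n - 2)"
      using grid_upper[OF assms] by (intro Inf_lower) (auto simp: iff)
    show "enat (n - 2) \<le> Inf {enat k | k. D_to_move (grid n) k {} {}}"
      by (intro Inf_greatest) (auto simp: iff dest: grid_lower)
  qed
  then show ?thesis by (simp add: gamma_MB_def)
qed

end
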